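(* Let $(M,g,J)$ be an almost hermitian manifold of real dimension $2n$ with trivial canonical bundle and associated parallel $(n,0)$-form $\psi$. Then $\phi=\mathrm{Re}(\psi)$ is a generalized calibration of degree $n$ on $M$, and its contact set at every point of $M$ is $SU(n)/SO(n)$, i.e. the set of oriented $n$-planes $\xi\subset T_pM$ with $\phi(\xi)=1$ is a single $SU(n)$-orbit isomorphic to $SU(n)/SO(n)$.
   Context: Here $\psi$ is a nowhere vanishing $(n,0)$-form which is parallel with respect to a connection $\nabla$ (possibly with torsion) satisfying $\nabla g=\nabla J=\nabla\psi=0$ (so the holonomy of $\nabla$ is contained in $SU(n)$), normalized by $(-1)^{n(n-1)/2}(i/2)^n\,\psi\wedge\bar\psi=d\mathrm{vol}_g$. $SU(n)$ denotes the group of linear isometries of $T_pM$ preserving $J$ and $\psi$. A generalized calibration of degree $m$ is an $m$-form $\phi$ (not necessarily closed) such that $\phi(\xi)|_p\le1$ for every $p\in M$ and every oriented $m$-plane $\xi\subset T_pM$, where $\phi(\xi)$ is $\phi$ evaluated on an oriented orthonormal basis of $\xi$. The contact set at $p$ is the set of oriented $m$-planes $\xi\subset T_pM$ with $\phi(\xi)=1$. *)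

theory Defs
  imports
    "HOL-Analysis.Derivative"
    "HOL-Analysis.T1_Spaces"
    "HOL-Analysis.Abstract_Topological_Spaces"
    "HOL-Library.Function_Algebras"
    "HOL-Combinatorics.Permutations"
    "HOL-Algebra.Group_Action"
    "HOL-Algebra.Left_Coset"
    "Jordan_Normal_Form.Determinant"
    "Jordan_Normal_Form.Schur_Decomposition"
begin

section \<open>Pointwise real vector space structure on functions\<close>

instantiation "fun" :: (type, scaleR) scaleR
begin
definition scaleR_fun_def: "r *\<^sub>R f = (\<lambda>x. r *\<^sub>R f x)"
instance ..
end

lemma scaleR_fun_apply [simp]: "(r *\<^sub>R f) x = r *\<^sub>R f x"
  by (simp add: scaleR_fun_def)

instance "fun" :: (type, real_vector) real_vector
  by standard (simp_all add: fun_eq_iff scaleR_add_right scaleR_add_left)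


section \<open>Smooth manifolds\<close>

text \<open>On an open set, all iterated directional derivatives up to order \<open>k\<close> exist
  as Frechet derivatives and are continuous.\<close>

fun Ck_on :: "nat \<Rightarrow> ('b::real_normed_vector \<Rightarrow> 'c::real_normed_vector) \<Rightarrow> 'b set \<Rightarrow> bool" where
  "Ck_on 0 f S \<longleftrightarrow> continuous_on S f"
| "Ck_on (Suc k) f S \<longleftrightarrow>
     (\<forall>x\<in>S. f differentiable (at x)) \<and> (\<forall>v. Ck_on k (\<lambda>x. frechet_derivative f (at x) v) S)"

definition smooth_on :: "('b::real_normed_vector \<Rightarrow> 'c::real_normed_vector) \<Rightarrow> 'b set \<Rightarrow> bool" where
  "smooth_on f S \<longleftrightarrow> (\<forall>k. Ck_on k f S)"

type_synonym ('a, 'e) chart = "'a set \<times> ('a \<Rightarrow> 'e)"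

definition chart_inv :: "('a, 'e) chart \<Rightarrow> 'e \<Rightarrow> 'a" where
  "chart_inv c = inv_into (fst c) (snd c)"

definition transition :: "('a, 'e) chart \<Rightarrow> ('a, 'e) chart \<Rightarrow> 'e \<Rightarrow> 'e" where
  "transition c d = snd d \<circ> chart_inv c"

definition smooth_manifold :: "'a topology \<Rightarrow> ('a, 'e::euclidean_space) chart set \<Rightarrow> bool" where
  "smooth_manifold X A \<longleftrightarrow>
     Hausdorff_space X \<and> second_countable X \<and>
     (\<Union>c\<in>A. fst c) = topspace X \<and>
     (\<forall>c\<in>A. openin X (fst c) \<and> open (snd c ` fst c) \<and>
        homeomorphic_map (subtopology X (fst c)) (top_of_set (snd c ` fst c)) (snd c)) \<and>
     (\<forall>c\<in>A. \<forall>d\<in>A. smooth_on (transition c d) (snd c ` (fst c \<inter> fst d)))"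

definition smooth_fun :: "('a, 'e::euclidean_space) chart set \<Rightarrow> ('a \<Rightarrow> 'b::real_normed_vector) \<Rightarrow> bool" where
  "smooth_fun A f \<longleftrightarrow> (\<forall>c\<in>A. smooth_on (f \<circ> chart_inv c) (snd c ` fst c))"


section \<open>Tangent vectors and vector fields\<close>

text \<open>A tangent vector at \<open>p\<close> is the family of its coordinate representations in the charts
  around \<open>p\<close>, related by the differentials of the transition maps, and (for uniqueness of the
  representation) zero in all other places.\<close>

type_synonym ('a, 'e) tvec = "('a, 'e) chart \<Rightarrow> 'e"

definition tangent_space :: "('a, 'e::euclidean_space) chart set \<Rightarrow> 'a \<Rightarrow> ('a, 'e) tvec set" where
  "tangent_space A p =
     {v. (\<forall>c. \<not> (c \<in> A \<and> p \<in> fst c) \<longrightarrow> v c = 0) \<and>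
         (\<forall>c\<in>A. \<forall>d\<in>A. p \<in> fst c \<and> p \<in> fst d \<longrightarrow>
            v d = frechet_derivative (transition c d) (at (snd c p)) (v c))}"

text \<open>The tangent vector at \<open>p\<close> that is represented by \<open>a\<close> in the chart \<open>c\<close>.\<close>

definition coord_vector ::
    "('a, 'e::euclidean_space) chart set \<Rightarrow> ('a, 'e) chart \<Rightarrow> 'a \<Rightarrow> 'e \<Rightarrow> ('a, 'e) tvec" where
  "coord_vector A c p a =
     (\<lambda>d. if d \<in> A \<and> p \<in> fst d then frechet_derivative (transition c d) (at (snd c p)) a else 0)"

definition vector_field ::
    "'a topology \<Rightarrow> ('a, 'e::euclidean_space) chart set \<Rightarrow> ('a \<Rightarrow> ('a, 'e) tvec) \<Rightarrow> bool" where
  "vector_field X A Y \<longleftrightarrow>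
     (\<forall>p\<in>topspace X. Y p \<in> tangent_space A p) \<and>
     (\<forall>c\<in>A. smooth_on (\<lambda>x. Y (chart_inv c x) c) (snd c ` fst c))"

text \<open>Derivative of \<open>f\<close> at \<open>p\<close> in the direction \<open>v\<close>; independent of the chart around \<open>p\<close>
  when \<open>v\<close> is tangent at \<open>p\<close>.\<close>

definition dir_deriv ::
    "('a, 'e::euclidean_space) chart set \<Rightarrow> 'a \<Rightarrow> ('a, 'e) tvec \<Rightarrow> ('a \<Rightarrow> 'b::real_normed_vector) \<Rightarrow> 'b" where
  "dir_deriv A p v f =
     (let c = (SOME c. c \<in> A \<and> p \<in> fst c)
      in frechet_derivative (f \<circ> chart_inv c) (at (snd c p)) (v c))"


section \<open>Tensors\<close>

definition linear_endo_on :: "'t::real_vector set \<Rightarrow> ('t \<Rightarrow> 't) \<Rightarrow> bool" where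
  "linear_endo_on T h \<longleftrightarrow>
     h \<in> T \<rightarrow> T \<and>
     (\<forall>u\<in>T. \<forall>v\<in>T. \<forall>a b. h (a *\<^sub>R u + b *\<^sub>R v) = a *\<^sub>R h u + b *\<^sub>R h v)"

definition inner_product_on :: "'t::real_vector set \<Rightarrow> ('t \<Rightarrow> 't \<Rightarrow> real) \<Rightarrow> bool" where
  "inner_product_on T G \<longleftrightarrow>
     (\<forall>u\<in>T. \<forall>v\<in>T. G u v = G v u) \<and>
     (\<forall>u\<in>T. \<forall>v\<in>T. \<forall>w\<in>T. \<forall>a b. G (a *\<^sub>R u + b *\<^sub>R v) w = a * G u w + b * G v w) \<and>
     (\<forall>u\<in>T. u \<noteq> 0 \<longrightarrow> G u u > 0)"

text \<open>An \<open>m\<close>-form takes the tuple of its arguments as a function on \<open>nat\<close>, of which only the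
  values at \<open>0, \<dots>, m - 1\<close> matter.\<close>

definition alternating_on ::
    "'t::real_vector set \<Rightarrow> nat \<Rightarrow> ((nat \<Rightarrow> 't) \<Rightarrow> 'v::real_vector) \<Rightarrow> bool" where
  "alternating_on T m \<omega> \<longleftrightarrow>
     (\<forall>w w'. (\<forall>i<m. w i = w' i) \<longrightarrow> \<omega> w = \<omega> w') \<and>
     (\<forall>w \<in> {..<m} \<rightarrow> T. \<forall>k<m. \<forall>u\<in>T. \<forall>v\<in>T. \<forall>a b.
        \<omega> (w(k := a *\<^sub>R u + b *\<^sub>R v)) = a *\<^sub>R \<omega> (w(k := u)) + b *\<^sub>R \<omega> (w(k := v))) \<and>
     (\<forall>w \<in> {..<m} \<rightarrow> T. \<forall>i<m. \<forall>j<m. i \<noteq> j \<and> w i = w j \<longrightarrow> \<omega> w = 0)"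

definition wedge ::
    "nat \<Rightarrow> nat \<Rightarrow> ((nat \<Rightarrow> 't) \<Rightarrow> complex) \<Rightarrow> ((nat \<Rightarrow> 't) \<Rightarrow> complex) \<Rightarrow> (nat \<Rightarrow> 't) \<Rightarrow> complex" where
  "wedge k l \<alpha> \<beta> w =
     (\<Sum>\<sigma> | \<sigma> permutes {..<k + l}.
        of_int (sign \<sigma>) * \<alpha> (\<lambda>i. w (\<sigma> i)) * \<beta> (\<lambda>i. w (\<sigma> (k + i)))) / (fact k * fact l)"

definition differential_form ::
    "'a topology \<Rightarrow> ('a, 'e::euclidean_space) chart set \<Rightarrow> nat \<Rightarrow>
     ('a \<Rightarrow> (nat \<Rightarrow> ('a, 'e) tvec) \<Rightarrow> 'v::real_normed_vector) \<Rightarrow> bool" where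
  "differential_form X A m \<omega> \<longleftrightarrow>
     (\<forall>p\<in>topspace X. alternating_on (tangent_space A p) m (\<omega> p)) \<and>
     (\<forall>c\<in>A. \<forall>a. smooth_on
        (\<lambda>x. \<omega> (chart_inv c x) (\<lambda>i. coord_vector A c (chart_inv c x) (a i))) (snd c ` fst c))"

definition riemannian_metric ::
    "'a topology \<Rightarrow> ('a, 'e::euclidean_space) chart set \<Rightarrow>
     ('a \<Rightarrow> ('a, 'e) tvec \<Rightarrow> ('a, 'e) tvec \<Rightarrow> real) \<Rightarrow> bool" where
  "riemannian_metric X A g \<longleftrightarrow>
     (\<forall>p\<in>topspace X. inner_product_on (tangent_space A p) (g p)) \<and>
     (\<forall>c\<in>A. \<forall>a b. smooth_on
        (\<lambda>x. g (chart_inv c x) (coord_vector A c (chart_inv c x) a) (coord_vector A c (chart_inv c x) b))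
        (snd c ` fst c))"

definition almost_complex_structure ::
    "'a topology \<Rightarrow> ('a, 'e::euclidean_space) chart set \<Rightarrow>
     ('a \<Rightarrow> ('a, 'e) tvec \<Rightarrow> ('a, 'e) tvec) \<Rightarrow> bool" where
  "almost_complex_structure X A J \<longleftrightarrow>
     (\<forall>p\<in>topspace X. linear_endo_on (tangent_space A p) (J p) \<and>
        (\<forall>v\<in>tangent_space A p. J p (J p v) = - v)) \<and>
     (\<forall>c\<in>A. \<forall>a. smooth_on
        (\<lambda>x. J (chart_inv c x) (coord_vector A c (chart_inv c x) a) c) (snd c ` fst c))"

definition almost_hermitian_manifold ::
    "'a topology \<Rightarrow> ('a, 'e::euclidean_space) chart set \<Rightarrow> nat \<Rightarrow>
     ('a \<Rightarrow> ('a, 'e) tvec \<Rightarrow> ('a, 'e) tvec \<Rightarrow> real) \<Rightarrow>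
     ('a \<Rightarrow> ('a, 'e) tvec \<Rightarrow> ('a, 'e) tvec) \<Rightarrow> bool" where
  "almost_hermitian_manifold X A n g J \<longleftrightarrow>
     smooth_manifold X A \<and> DIM('e) = 2 * n \<and>
     riemannian_metric X A g \<and> almost_complex_structure X A J \<and>
     (\<forall>p\<in>topspace X. \<forall>u\<in>tangent_space A p. \<forall>v\<in>tangent_space A p. g p (J p u) (J p v) = g p u v)"

text \<open>A complex-valued real-multilinear form has type \<open>(n, 0)\<close> iff its complex-multilinear
  extension vanishes on the vectors \<open>v + \<i> J v\<close> of type \<open>(0, 1)\<close> in each slot, that is
  \<open>\<psi>(\<dots>, v, \<dots>) + \<i> \<psi>(\<dots>, J v, \<dots>) = 0\<close>.\<close>

definition n0_form ::
    "'a topology \<Rightarrow> ('a, 'e::euclidean_space) chart set \<Rightarrow> ('a \<Rightarrow> ('a, 'e) tvec \<Rightarrow> ('a, 'e) tvec) \<Rightarrow>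
     nat \<Rightarrow> ('a \<Rightarrow> (nat \<Rightarrow> ('a, 'e) tvec) \<Rightarrow> complex) \<Rightarrow> bool" where
  "n0_form X A J n \<psi> \<longleftrightarrow>
     differential_form X A n \<psi> \<and>
     (\<forall>p\<in>topspace X. \<forall>w \<in> {..<n} \<rightarrow> tangent_space A p. \<forall>k<n.
        \<psi> p w + \<i> * \<psi> p (w(k := J p (w k))) = 0)"

text \<open>Such a form is a global frame of the canonical line bundle, i.e. it trivializes it.\<close>

definition nowhere_vanishing ::
    "'a topology \<Rightarrow> ('a, 'e::euclidean_space) chart set \<Rightarrow> nat \<Rightarrow>
     ('a \<Rightarrow> (nat \<Rightarrow> ('a, 'e) tvec) \<Rightarrow> complex) \<Rightarrow> bool" where
  "nowhere_vanishing X A n \<psi> \<longleftrightarrow>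
     (\<forall>p\<in>topspace X. \<exists>w \<in> {..<n} \<rightarrow> tangent_space A p. \<psi> p w \<noteq> 0)"


section \<open>Connections and parallel tensors\<close>

text \<open>Torsion is not restricted. Values of vector fields outside of \<open>topspace X\<close> do not influence
  \<open>D\<close> on \<open>topspace X\<close>, by the product rules for a function \<open>f\<close> that is \<open>0\<close> there and \<open>1\<close> elsewhere.\<close>

definition affine_connection ::
    "'a topology \<Rightarrow> ('a, 'e::euclidean_space) chart set \<Rightarrow>
     (('a \<Rightarrow> ('a, 'e) tvec) \<Rightarrow> ('a \<Rightarrow> ('a, 'e) tvec) \<Rightarrow> ('a \<Rightarrow> ('a, 'e) tvec)) \<Rightarrow> bool" where
  "affine_connection X A D \<longleftrightarrow>
     (\<forall>Y Z. vector_field X A Y \<and> vector_field X A Z \<longrightarrow> vector_field X A (D Y Z)) \<and>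
     (\<forall>Y Y' Z. vector_field X A Y \<and> vector_field X A Y' \<and> vector_field X A Z \<longrightarrow>
        (\<forall>p\<in>topspace X.
           D (\<lambda>q. Y q + Y' q) Z p = D Y Z p + D Y' Z p \<and>
           D Z (\<lambda>q. Y q + Y' q) p = D Z Y p + D Z Y' p)) \<and>
     (\<forall>f Y Z. smooth_fun A f \<and> vector_field X A Y \<and> vector_field X A Z \<longrightarrow>
        (\<forall>p\<in>topspace X.
           D (\<lambda>q. f q *\<^sub>R Y q) Z p = f p *\<^sub>R D Y Z p \<and>
           D Y (\<lambda>q. f q *\<^sub>R Z q) p = dir_deriv A p (Y p) f *\<^sub>R Z p + f p *\<^sub>R D Y Z p))"

definition parallel_metric ::
    "'a topology \<Rightarrow> ('a, 'e::euclidean_space) chart set \<Rightarrow>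
     (('a \<Rightarrow> ('a, 'e) tvec) \<Rightarrow> ('a \<Rightarrow> ('a, 'e) tvec) \<Rightarrow> ('a \<Rightarrow> ('a, 'e) tvec)) \<Rightarrow> ('a \<Rightarrow> ('a, 'e) tvec \<Rightarrow> ('a, 'e) tvec \<Rightarrow> real) \<Rightarrow> bool" where
  "parallel_metric X A D g \<longleftrightarrow>
     (\<forall>U Y Z. vector_field X A U \<and> vector_field X A Y \<and> vector_field X A Z \<longrightarrow>
        (\<forall>p\<in>topspace X. dir_deriv A p (U p) (\<lambda>q. g q (Y q) (Z q)) =
           g p (D U Y p) (Z p) + g p (Y p) (D U Z p)))"

definition parallel_endo ::
    "'a topology \<Rightarrow> ('a, 'e::euclidean_space) chart set \<Rightarrow>
     (('a \<Rightarrow> ('a, 'e) tvec) \<Rightarrow> ('a \<Rightarrow> ('a, 'e) tvec) \<Rightarrow> ('a \<Rightarrow> ('a, 'e) tvec)) \<Rightarrow> ('a \<Rightarrow> ('a, 'e) tvec \<Rightarrow> ('a, 'e) tvec) \<Rightarrow> bool" where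
  "parallel_endo X A D J \<longleftrightarrow>
     (\<forall>U Y. vector_field X A U \<and> vector_field X A Y \<longrightarrow>
        (\<forall>p\<in>topspace X. D U (\<lambda>q. J q (Y q)) p = J p (D U Y p)))"

definition parallel_form ::
    "'a topology \<Rightarrow> ('a, 'e::euclidean_space) chart set \<Rightarrow>
     (('a \<Rightarrow> ('a, 'e) tvec) \<Rightarrow> ('a \<Rightarrow> ('a, 'e) tvec) \<Rightarrow> ('a \<Rightarrow> ('a, 'e) tvec)) \<Rightarrow> nat \<Rightarrow>
     ('a \<Rightarrow> (nat \<Rightarrow> ('a, 'e) tvec) \<Rightarrow> 'v::real_normed_vector) \<Rightarrow> bool" where
  "parallel_form X A D m \<omega> \<longleftrightarrow>
     (\<forall>U Y. vector_field X A U \<and> (\<forall>i<m. vector_field X A (Y i)) \<longrightarrow>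
        (\<forall>p\<in>topspace X. dir_deriv A p (U p) (\<lambda>q. \<omega> q (\<lambda>i. Y i q)) =
           (\<Sum>k<m. \<omega> p ((\<lambda>i. Y i p)(k := D U (Y k) p)))))"


section \<open>Volume form\<close>

definition orthonormal :: "('t \<Rightarrow> 't \<Rightarrow> real) \<Rightarrow> nat \<Rightarrow> (nat \<Rightarrow> 't) \<Rightarrow> bool" where
  "orthonormal G m w \<longleftrightarrow> (\<forall>i<m. \<forall>j<m. G (w i) (w j) = (if i = j then 1 else 0))"

text \<open>\<open>e\<^sub>0, \<dots>, e\<^bsub>n-1\<^esub>\<close> is orthonormal for the hermitian inner product belonging to \<open>G\<close> and \<open>J\<close>,
  i.e. \<open>e\<^sub>0, J e\<^sub>0, \<dots>, e\<^bsub>n-1\<^esub>, J e\<^bsub>n-1\<^esub>\<close> is \<open>G\<close>-orthonormal.\<close>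

definition unitary_frame ::
    "'t set \<Rightarrow> ('t \<Rightarrow> 't \<Rightarrow> real) \<Rightarrow> ('t \<Rightarrow> 't) \<Rightarrow> nat \<Rightarrow> (nat \<Rightarrow> 't) \<Rightarrow> bool" where
  "unitary_frame T G J n e \<longleftrightarrow>
     e \<in> {..<n} \<rightarrow> T \<and>
     orthonormal G (2 * n) (\<lambda>k. if even k then e (k div 2) else J (e (k div 2)))"

text \<open>\<open>\<mu>\<close> is the Riemannian volume form, for the orientation given by \<open>J\<close>, i.e. the one in which
  \<open>e\<^sub>0, J e\<^sub>0, \<dots>, e\<^bsub>n-1\<^esub>, J e\<^bsub>n-1\<^esub>\<close> is positively oriented; it is complex-valued only so that
  complex expressions can be compared with it.\<close>

definition volume_form_on ::
    "'t::real_vector set \<Rightarrow> ('t \<Rightarrow> 't \<Rightarrow> real) \<Rightarrow> ('t \<Rightarrow> 't) \<Rightarrow> nat \<Rightarrow> ((nat \<Rightarrow> 't) \<Rightarrow> complex) \<Rightarrow> bool" where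
  "volume_form_on T G J n \<mu> \<longleftrightarrow>
     alternating_on T (2 * n) \<mu> \<and>
     (\<forall>e. unitary_frame T G J n e \<longrightarrow>
        \<mu> (\<lambda>k. if even k then e (k div 2) else J (e (k div 2))) = 1)"

definition volume_normalized ::
    "'a topology \<Rightarrow> ('a, 'e::euclidean_space) chart set \<Rightarrow> nat \<Rightarrow>
     ('a \<Rightarrow> ('a, 'e) tvec \<Rightarrow> ('a, 'e) tvec \<Rightarrow> real) \<Rightarrow>
     ('a \<Rightarrow> ('a, 'e) tvec \<Rightarrow> ('a, 'e) tvec) \<Rightarrow>
     ('a \<Rightarrow> (nat \<Rightarrow> ('a, 'e) tvec) \<Rightarrow> complex) \<Rightarrow> bool" where
  "volume_normalized X A n g J \<psi> \<longleftrightarrow>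
     (\<forall>p\<in>topspace X. volume_form_on (tangent_space A p) (g p) (J p) n
        (\<lambda>w. (- 1) ^ (n * (n - 1) div 2) * (\<i> / 2) ^ n * wedge n n (\<psi> p) (\<lambda>u. cnj (\<psi> p u)) w))"


section \<open>Oriented planes, calibrations and contact sets\<close>

definition frames :: "'t::real_vector set \<Rightarrow> nat \<Rightarrow> (nat \<Rightarrow> 't) set" where
  "frames T m = {w \<in> {..<m} \<rightarrow>\<^sub>E T. inj_on w {..<m} \<and> independent (w ` {..<m})}"

text \<open>An oriented \<open>m\<close>-plane (for \<open>m > 0\<close>) is encoded as the set of its positively oriented ordered
  bases, i.e. as a class of linearly independent \<open>m\<close>-tuples modulo base changes of positive
  determinant.\<close>

definition oriented_span :: "nat \<Rightarrow> (nat \<Rightarrow> 't::real_vector) \<Rightarrow> (nat \<Rightarrow> 't) set" where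
  "oriented_span m w =
     {(\<lambda>i\<in>{..<m}. \<Sum>j<m. (B $$ (i, j)) *\<^sub>R w j) | B. B \<in> carrier_mat m m \<and> Determinant.det B > 0}"

definition oriented_planes :: "'t::real_vector set \<Rightarrow> nat \<Rightarrow> (nat \<Rightarrow> 't) set set" where
  "oriented_planes T m = oriented_span m ` frames T m"

text \<open>The value of a form on an oriented plane: on any positively oriented orthonormal basis.\<close>

definition eval_plane ::
    "('t \<Rightarrow> 't \<Rightarrow> real) \<Rightarrow> nat \<Rightarrow> ((nat \<Rightarrow> 't) \<Rightarrow> real) \<Rightarrow> (nat \<Rightarrow> 't) set \<Rightarrow> real" where
  "eval_plane G m \<phi> \<xi> = \<phi> (SOME w. w \<in> \<xi> \<and> orthonormal G m w)"

definition generalized_calibration ::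
    "'a topology \<Rightarrow> ('a, 'e::euclidean_space) chart set \<Rightarrow>
     ('a \<Rightarrow> ('a, 'e) tvec \<Rightarrow> ('a, 'e) tvec \<Rightarrow> real) \<Rightarrow> nat \<Rightarrow>
     ('a \<Rightarrow> (nat \<Rightarrow> ('a, 'e) tvec) \<Rightarrow> real) \<Rightarrow> bool" where
  "generalized_calibration X A g m \<phi> \<longleftrightarrow>
     differential_form X A m \<phi> \<and>
     (\<forall>p\<in>topspace X. \<forall>\<xi>\<in>oriented_planes (tangent_space A p) m. eval_plane (g p) m (\<phi> p) \<xi> \<le> 1)"

definition contact_set ::
    "('a, 'e::euclidean_space) chart set \<Rightarrow>
     ('a \<Rightarrow> ('a, 'e) tvec \<Rightarrow> ('a, 'e) tvec \<Rightarrow> real) \<Rightarrow> nat \<Rightarrow>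
     ('a \<Rightarrow> (nat \<Rightarrow> ('a, 'e) tvec) \<Rightarrow> real) \<Rightarrow> 'a \<Rightarrow> (nat \<Rightarrow> ('a, 'e) tvec) set set" where
  "contact_set A g m \<phi> p = {\<xi> \<in> oriented_planes (tangent_space A p) m. eval_plane (g p) m (\<phi> p) \<xi> = 1}"


section \<open>Special unitary groups and homogeneous spaces\<close>

definition SU_group ::
    "'t::real_vector set \<Rightarrow> ('t \<Rightarrow> 't \<Rightarrow> real) \<Rightarrow> ('t \<Rightarrow> 't) \<Rightarrow> nat \<Rightarrow> ((nat \<Rightarrow> 't) \<Rightarrow> complex) \<Rightarrow>
     ('t \<Rightarrow> 't) monoid" where
  "SU_group T G J n \<psi> = BijGroup T \<lparr>carrier :=
     {h \<in> Bij T. linear_endo_on T h \<and>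
        (\<forall>u\<in>T. \<forall>v\<in>T. G (h u) (h v) = G u v) \<and>
        (\<forall>v\<in>T. h (J v) = J (h v)) \<and>
        (\<forall>w \<in> {..<n} \<rightarrow> T. \<psi> (\<lambda>i. h (w i)) = \<psi> w)}\<rparr>"

definition plane_image :: "nat \<Rightarrow> ('t \<Rightarrow> 't) \<Rightarrow> (nat \<Rightarrow> 't) set \<Rightarrow> (nat \<Rightarrow> 't) set" where
  "plane_image m h \<xi> = (\<lambda>w. \<lambda>i\<in>{..<m}. h (w i)) ` \<xi>"

definition SU_mat :: "nat \<Rightarrow> complex mat monoid" where
  "SU_mat n = \<lparr>carrier = {B \<in> carrier_mat n n. B * mat_adjoint B = 1\<^sub>m n \<and> Determinant.det B = 1},
     mult = (*), one = 1\<^sub>m n\<rparr>"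

definition SO_mat :: "nat \<Rightarrow> complex mat set" where
  "SO_mat n = {map_mat complex_of_real B | B :: real mat. B \<in> carrier_mat n n \<and>
     B * transpose_mat B = 1\<^sub>m n \<and> Determinant.det B = 1}"

text \<open>\<open>\<Phi>\<close> and \<open>F\<close> identify the \<open>K\<close>-set \<open>E\<close> with the homogeneous space \<open>G/H\<close> of left cosets, on
  which \<open>G\<close> acts by left translation.\<close>

definition homogeneous_space_iso ::
    "('g, 'x) monoid_scheme \<Rightarrow> 'g set \<Rightarrow> ('k, 'y) monoid_scheme \<Rightarrow> 's set \<Rightarrow> ('k \<Rightarrow> 's \<Rightarrow> 's) \<Rightarrow>
     ('g \<Rightarrow> 'k) \<Rightarrow> ('g set \<Rightarrow> 's) \<Rightarrow> bool" where
  "homogeneous_space_iso G H K E act \<Phi> F \<longleftrightarrow>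
     \<Phi> \<in> iso G K \<and> subgroup H G \<and> bij_betw F (LCOSETS G H) E \<and>
     (\<forall>a\<in>carrier G. \<forall>Q\<in>LCOSETS G H. F (l_coset G a Q) = act (\<Phi> a) (F Q))"

text \<open>\<open>h\<close> has the complex matrix \<open>B\<close> with respect to the frame \<open>e\<close>, where \<open>\<i>\<close> acts as \<open>J\<close>.\<close>

definition has_matrix :: "('t::real_vector \<Rightarrow> 't) \<Rightarrow> nat \<Rightarrow> (nat \<Rightarrow> 't) \<Rightarrow> ('t \<Rightarrow> 't) \<Rightarrow> complex mat \<Rightarrow> bool" where
  "has_matrix J n e h B \<longleftrightarrow>
     (\<forall>j<n. h (e j) = (\<Sum>i<n. Re (B $$ (i, j)) *\<^sub>R e i + Im (B $$ (i, j)) *\<^sub>R J (e i)))"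

end

theory Submission
  imports Defs
begin

text \<open>Everything happens in a single tangent space. In a unitary frame \<open>e\<close> the form \<open>\<psi>\<close> is
  \<open>\<psi>(e)\<close> times the complex determinant, and the volume normalization says exactly
  \<open>\<bar>\<psi>(e)\<bar> = 1\<close>. Hadamard's inequality then gives \<open>\<bar>\<psi>(w)\<bar> \<le> 1\<close> for real orthonormal \<open>w\<close>, with
  equality iff \<open>w\<close> is unitary. So the planes of contact are the real spans of the unitary frames with
  \<open>\<psi> = 1\<close>. On these frames \<open>SU(n)\<close> acts simply transitively, and an element fixes the oriented
  real span of such a frame iff its matrix in the frame is real, i.e. lies in \<open>SO(n)\<close>. The
  connection plays no role in this.\<close>


section \<open>Hermitian linear algebra\<close>

text \<open>A tangent space is only a real subspace of a function type, so complex linear algebra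
  has to be rebuilt on it from \<open>J\<close> and \<open>G\<close>, and unitary frames are the
  bridge to matrices. The choice between matrices and vectors follows the information that is
  wanted. The modulus of \<open>\<psi>\<close> on a unitary frame is a determinant computation:
  expanding the wedge product of \<open>\<psi>\<close> with its conjugate on a real basis counts one
  determinant of size \<open>2 * n\<close> exactly \<open>fact n * fact n\<close> times, which
  cancels the denominators in \<open>wedge\<close>. Hadamard's inequality is instead obtained by
  orthogonalizing the arguments of \<open>\<psi>\<close>, because then the equality case can be read
  off: any proper rescaling loses modulus. Since \<open>Re \<psi> = 1\<close> and modulus at most
  \<open>1\<close> force \<open>\<psi> = 1\<close>, contact fixes the phase as well. In the
  stabilizer, a matrix that maps the real span of the frame to itself is real, and its determinant
  is already \<open>1\<close>, so preservation of the orientation is automatic.\<close>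

locale hermitian_space =
  fixes T :: "'t::real_vector set" and G :: "'t \<Rightarrow> 't \<Rightarrow> real" and J :: "'t \<Rightarrow> 't"
  assumes subspace_T: "real_vector.subspace T"
    and inner: "inner_product_on T G"
    and J_endo: "linear_endo_on T J"
    and JJ: "v \<in> T \<Longrightarrow> J (J v) = - v"
    and G_JJ: "\<lbrakk>u \<in> T; v \<in> T\<rbrakk> \<Longrightarrow> G (J u) (J v) = G u v"
begin

lemma zero_T [simp, intro]: "0 \<in> T"
  and add_T [simp, intro]: "u \<in> T \<Longrightarrow> v \<in> T \<Longrightarrow> u + v \<in> T"
  and diff_T [simp, intro]: "u \<in> T \<Longrightarrow> v \<in> T \<Longrightarrow> u - v \<in> T"
  and scaleR_T [simp, intro]: "u \<in> T \<Longrightarrow> r *\<^sub>R u \<in> T"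
  and uminus_T [simp, intro]: "u \<in> T \<Longrightarrow> - u \<in> T"
  using subspace_T by (auto simp: real_vector.subspace_def real_vector.subspace_diff real_vector.subspace_neg)

lemma sum_T [simp, intro]: "(\<And>i. i < k \<Longrightarrow> f i \<in> T) \<Longrightarrow> (\<Sum>i<(k::nat). f i) \<in> T"
  using subspace_T by (auto intro: real_vector.subspace_sum)

lemma J_T [simp, intro]: "u \<in> T \<Longrightarrow> J u \<in> T"
  using J_endo by (auto simp: linear_endo_on_def)

lemma J_lincomb: "u \<in> T \<Longrightarrow> v \<in> T \<Longrightarrow> J (a *\<^sub>R u + b *\<^sub>R v) = a *\<^sub>R J u + b *\<^sub>R J v"
  using J_endo by (auto simp: linear_endo_on_def)

lemma J_add: "u \<in> T \<Longrightarrow> v \<in> T \<Longrightarrow> J (u + v) = J u + J v"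
  using J_lincomb[of u v 1 1] by simp

lemma J_scaleR: "u \<in> T \<Longrightarrow> J (a *\<^sub>R u) = a *\<^sub>R J u"
  using J_lincomb[of u u a 0] by simp

lemma J_zero: "J 0 = 0"
  using J_scaleR[of 0 0] by simp

lemma G_sym: "u \<in> T \<Longrightarrow> v \<in> T \<Longrightarrow> G u v = G v u"
  using inner by (auto simp: inner_product_on_def)

lemma G_lincomb: "u \<in> T \<Longrightarrow> v \<in> T \<Longrightarrow> w \<in> T \<Longrightarrow> G (a *\<^sub>R u + b *\<^sub>R v) w = a * G u w + b * G v w"
  using inner by (auto simp: inner_product_on_def)

lemma G_pos: "u \<in> T \<Longrightarrow> u \<noteq> 0 \<Longrightarrow> G u u > 0"
  using inner by (auto simp: inner_product_on_def)

lemma G_add: "u \<in> T \<Longrightarrow> v \<in> T \<Longrightarrow> w \<in> T \<Longrightarrow> G (u + v) w = G u w + G v w"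
  using G_lincomb[of u v w 1 1] by simp

lemma G_scaleR: "u \<in> T \<Longrightarrow> w \<in> T \<Longrightarrow> G (a *\<^sub>R u) w = a * G u w"
  using G_lincomb[of u u w a 0] by simp

lemma G_zero: "w \<in> T \<Longrightarrow> G 0 w = 0"
  using G_scaleR[of 0 w 0] by simp

lemma G_sum:
  "(\<And>i. i < k \<Longrightarrow> f i \<in> T) \<Longrightarrow> w \<in> T \<Longrightarrow> G (\<Sum>i<(k::nat). f i) w = (\<Sum>i<k. G (f i) w)"
  by (induction k) (auto simp: G_zero G_add)

lemma G_uminus_right: "u \<in> T \<Longrightarrow> w \<in> T \<Longrightarrow> G u (- w) = - G u w"
  using G_scaleR[of w u "-1"] by (simp add: G_sym[of u])

lemma G_J_left: "u \<in> T \<Longrightarrow> v \<in> T \<Longrightarrow> G (J u) v = - G u (J v)"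
  using G_JJ[of "J u" v] G_scaleR[of u "J v" "-1"] by (simp add: JJ)

section \<open>Complex scalars and the hermitian form of a tangent space\<close>

definition cscale :: "complex \<Rightarrow> 't \<Rightarrow> 't" (infixr "\<star>" 75) where
  "z \<star> v = Re z *\<^sub>R v + Im z *\<^sub>R J v"

text \<open>Taking \<open>G u (J v)\<close> rather than \<open>G (J u) v\<close> as imaginary part
  makes the form linear in the first argument and conjugate linear in the second, so that
  \<open>herm v (e i)\<close> is the coefficient of \<open>e i\<close> in an expansion of
  \<open>v\<close>.\<close>

definition herm :: "'t \<Rightarrow> 't \<Rightarrow> complex" where
  "herm u v = Complex (G u v) (G u (J v))"

lemma cscale_T [simp, intro]: "v \<in> T \<Longrightarrow> z \<star> v \<in> T"
  by (auto simp: cscale_def)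

lemma cscale_of_real [simp]: "of_real r \<star> v = r *\<^sub>R v"
  by (simp add: cscale_def)

lemma cscale_one [simp]: "1 \<star> v = v"
  and cscale_zero [simp]: "0 \<star> v = 0"
  by (simp_all add: cscale_def)

lemma cscale_zero_right [simp]: "z \<star> 0 = 0"
  by (simp add: cscale_def J_zero)

lemma cscale_i: "\<i> \<star> v = J v"
  by (simp add: cscale_def)

lemma cscale_add_left: "(y + z) \<star> v = y \<star> v + z \<star> v"
  by (simp add: cscale_def algebra_simps)

lemma cscale_add_right: "u \<in> T \<Longrightarrow> v \<in> T \<Longrightarrow> z \<star> (u + v) = z \<star> u + z \<star> v"
  by (simp add: cscale_def J_add algebra_simps)

lemma cscale_cscale: "v \<in> T \<Longrightarrow> y \<star> z \<star> v = (y * z) \<star> v"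
  by (simp add: cscale_def J_lincomb JJ algebra_simps)

lemma cscale_sum_left: "sum f I \<star> v = (\<Sum>i\<in>I. f i \<star> v)"
  by (induction I rule: infinite_finite_induct) (auto simp: cscale_add_left)

lemma cscale_sum_right:
  "(\<And>i. i < k \<Longrightarrow> f i \<in> T) \<Longrightarrow> z \<star> (\<Sum>i<(k::nat). f i) = (\<Sum>i<k. z \<star> f i)"
  by (induction k) (auto simp: cscale_add_right)

lemma Re_herm: "Re (herm u v) = G u v"
  by (simp add: herm_def)

lemma herm_add: "u \<in> T \<Longrightarrow> v \<in> T \<Longrightarrow> w \<in> T \<Longrightarrow> herm (u + v) w = herm u w + herm v w"
  by (simp add: herm_def G_add complex_eq_iff)

lemma herm_cscale: "u \<in> T \<Longrightarrow> w \<in> T \<Longrightarrow> herm (z \<star> u) w = z * herm u w"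
  by (simp add: herm_def cscale_def G_lincomb complex_eq_iff G_J_left JJ G_uminus_right)

lemma herm_zero: "w \<in> T \<Longrightarrow> herm 0 w = 0"
  by (simp add: herm_def G_zero complex_eq_iff)

lemma herm_sum:
  "(\<And>i. i < k \<Longrightarrow> f i \<in> T) \<Longrightarrow> w \<in> T \<Longrightarrow> herm (\<Sum>i<(k::nat). f i) w = (\<Sum>i<k. herm (f i) w)"
  by (induction k) (auto simp: herm_zero herm_add)

lemma herm_cnj: "u \<in> T \<Longrightarrow> v \<in> T \<Longrightarrow> herm v u = cnj (herm u v)"
  using G_J_left[of u v] by (simp add: herm_def complex_eq_iff G_sym[of v u] G_sym[of v "J u"])

lemma herm_cscale_right: "u \<in> T \<Longrightarrow> w \<in> T \<Longrightarrow> herm u (z \<star> w) = cnj z * herm u w"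
  using herm_cscale[of w u z] herm_cnj[of "z \<star> w" u] herm_cnj[of w u] by simp

lemma herm_scaleR: "u \<in> T \<Longrightarrow> w \<in> T \<Longrightarrow> herm (r *\<^sub>R u) w = r * herm u w"
  using herm_cscale[of u w "of_real r"] by simp

lemma herm_scaleR_right: "u \<in> T \<Longrightarrow> w \<in> T \<Longrightarrow> herm u (r *\<^sub>R w) = r * herm u w"
  using herm_cscale_right[of u w "of_real r"] by simp

lemma herm_diff: "u \<in> T \<Longrightarrow> v \<in> T \<Longrightarrow> w \<in> T \<Longrightarrow> herm (u - v) w = herm u w - herm v w"
  using herm_add[of u "- v" w] herm_scaleR[of v w "-1"] by simp

lemma herm_sum_right:
  assumes "\<And>i. i < k \<Longrightarrow> f i \<in> T" "w \<in> T"
  shows "herm w (\<Sum>i<(k::nat). f i) = (\<Sum>i<k. herm w (f i))"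
  using herm_sum[of k f w] herm_cnj[of "\<Sum>i<k. f i" w] assms by (simp add: herm_cnj[of _ w])

lemma herm_self: "u \<in> T \<Longrightarrow> herm u u = of_real (G u u)"
  using G_J_left[of u u] G_sym[of "J u" u] by (simp add: herm_def complex_eq_iff)

lemma G_self_nonneg: "u \<in> T \<Longrightarrow> G u u \<ge> 0"
  using G_pos[of u] G_zero[of 0] by (cases "u = 0") auto

lemma G_eq_0_iff: "u \<in> T \<Longrightarrow> G u u = 0 \<longleftrightarrow> u = 0"
  using G_pos[of u] G_zero[of 0] by (cases "u = 0") auto

section \<open>Unitary families\<close>

definition unitary :: "nat \<Rightarrow> (nat \<Rightarrow> 't) \<Rightarrow> bool" where
  "unitary k e \<longleftrightarrow> e \<in> {..<k} \<rightarrow> T \<and> (\<forall>i<k. \<forall>j<k. herm (e i) (e j) = (if i = j then 1 else 0))"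

lemma unitary_T: "unitary k e \<Longrightarrow> i < k \<Longrightarrow> e i \<in> T"
  by (auto simp: unitary_def)

lemma unitary_herm: "unitary k e \<Longrightarrow> i < k \<Longrightarrow> j < k \<Longrightarrow> herm (e i) (e j) = (if i = j then 1 else 0)"
  by (auto simp: unitary_def)

abbreviation realify :: "(nat \<Rightarrow> 't) \<Rightarrow> nat \<Rightarrow> 't" where
  "realify e \<equiv> (\<lambda>k. if even k then e (k div 2) else J (e (k div 2)))"

text \<open>The real and the imaginary part of \<open>herm (e i) (e j)\<close> are the products
  under \<open>G\<close> of entry \<open>2 * i\<close> of the realified family with the entries
  \<open>2 * j\<close> and \<open>2 * j + 1\<close>; compatibility of \<open>G\<close> with
  \<open>J\<close> reduces the remaining products to these.\<close>

lemma unitary_frame_iff: "unitary_frame T G J k e \<longleftrightarrow> unitary k e"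
proof
  assume L: "unitary_frame T G J k e"
  have T: "e i \<in> T" if "i < k" for i using L that by (auto simp: unitary_frame_def)
  have o: "G (realify e a) (realify e b) = (if a = b then 1 else 0)" if "a < 2*k" "b < 2*k" for a b
    using L that unfolding unitary_frame_def orthonormal_def by blast
  have "herm (e i) (e j) = (if i = j then 1 else 0)" if "i < k" "j < k" for i j
    using o[of "2*i" "2*j"] o[of "2*i" "2*j+1"] that
    by (auto simp: herm_def complex_eq_iff)
  then show "unitary k e" using T by (auto simp: unitary_def)
next
  assume L: "unitary k e"
  have T: "e i \<in> T" if "i < k" for i using L that by (auto simp: unitary_def)
  have o: "G (e i) (e j) = (if i = j then 1 else 0)" "G (e i) (J (e j)) = 0" if "i < k" "j < k" for i j
    using unitary_herm[OF L that] by (auto simp: herm_def complex_eq_iff split: if_splits)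
  have "G (realify e a) (realify e b) = (if a = b then 1 else 0)" if "a < 2*k" "b < 2*k" for a b
  proof -
    have ab: "a div 2 < k" "b div 2 < k" using that by auto
    have "a = b \<longleftrightarrow> a div 2 = b div 2 \<and> (even a \<longleftrightarrow> even b)"
      by (metis dvd_div_mult_self odd_two_times_div_two_succ mult.commute)
    then show ?thesis
      using ab o T by (auto simp: G_J_left JJ G_uminus_right)
  qed
  then show "unitary_frame T G J k e" using T by (auto simp: unitary_frame_def orthonormal_def)
qed

text \<open>Serves twice: with the realified family it bounds the length of unitary families, and it
  makes an orthonormal tuple an admissible frame of a plane.\<close>

lemma orthonormal_independent:
  assumes w: "w \<in> {..<m} \<rightarrow> T" and o: "orthonormal G m w"
  shows "inj_on w {..<m} \<and> independent (w ` {..<m})"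
proof
  have wT: "w i \<in> T" if "i < m" for i using w that by auto
  show inj: "inj_on w {..<m}"
  proof (rule inj_onI)
    fix i j assume ij: "i \<in> {..<m}" "j \<in> {..<m}" "w i = w j"
    then have "G (w i) (w j) = 1" using o by (simp add: orthonormal_def)
    then show "i = j" using o ij(1,2) by (auto simp: orthonormal_def split: if_splits)
  qed
  show "independent (w ` {..<m})"
  proof (rule independent_if_scalars_zero)
    fix f x assume s: "(\<Sum>x\<in>w ` {..<m}. f x *\<^sub>R x) = 0" and "x \<in> w ` {..<m}"
    then obtain i where i: "i < m" "x = w i" by auto
    have "0 = G (\<Sum>x\<in>w ` {..<m}. f x *\<^sub>R x) (w i)" using s wT i by (simp add: G_zero)
    also have "\<dots> = G (\<Sum>j<m. f (w j) *\<^sub>R w j) (w i)" by (simp add: sum.reindex[OF inj])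
    also have "\<dots> = (\<Sum>j<m. f (w j) * G (w j) (w i))" using wT i by (simp add: G_sum G_scaleR)
    also have "\<dots> = (\<Sum>j<m. if j = i then f (w i) else 0)"
      using o i by (intro sum.cong) (auto simp: orthonormal_def)
    also have "\<dots> = f (w i)" using i by simp
    finally show "f x = 0" using i by simp
  qed simp
qed

text \<open>The one normalization step behind maximality, existence and the orthogonalization in the
  estimate of \<open>\<psi>\<close>: a nonzero vector orthogonal to the family prolongs it by
  one.\<close>

lemma unitary_extend:
  assumes e: "unitary k e" and r: "r \<in> T" "r \<noteq> 0" and o: "\<And>i. i < k \<Longrightarrow> herm r (e i) = 0"
  shows "unitary (Suc k) (e(k := (1 / sqrt (G r r)) *\<^sub>R r))"
proof -
  have T: "e i \<in> T" if "i < k" for i using e that by (auto simp: unitary_def)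
  have s: "sqrt (G r r) * sqrt (G r r) = G r r" "sqrt (G r r) \<noteq> 0"
    using G_pos[OF r] by auto
  have o': "herm (e i) r = 0" if "i < k" for i
    using o[OF that] herm_cnj[of r "e i"] T that r by simp
  have "herm ((1 / sqrt (G r r)) *\<^sub>R r) ((1 / sqrt (G r r)) *\<^sub>R r) = 1"
  proof -
    have "herm ((1 / sqrt (G r r)) *\<^sub>R r) ((1 / sqrt (G r r)) *\<^sub>R r)
        = of_real (1 / sqrt (G r r)) * (of_real (1 / sqrt (G r r)) * herm r r)"
      using r by (simp add: herm_scaleR herm_scaleR_right)
    also have "\<dots> = of_real (1 / sqrt (G r r) * (1 / sqrt (G r r)) * G r r)"
      by (simp only: herm_self[OF r(1)] of_real_mult mult.assoc)
    also have "1 / sqrt (G r r) * (1 / sqrt (G r r)) * G r r = 1"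
      using s by (simp add: field_simps)
    finally show ?thesis by simp
  qed
  then show ?thesis
    using e o o' T r by (auto simp: unitary_def herm_scaleR herm_scaleR_right less_Suc_eq)
qed

lemma herm_unitary_sum:
  assumes e: "unitary k e" and j: "j < k"
  shows "herm (\<Sum>i<k. z i \<star> e i) (e j) = z j"
proof -
  have T: "e i \<in> T" if "i < k" for i using e that by (auto simp: unitary_def)
  have "herm (\<Sum>i<k. z i \<star> e i) (e j) = (\<Sum>i<k. z i * herm (e i) (e j))"
    using T j by (simp add: herm_sum herm_cscale)
  also have "\<dots> = (\<Sum>i<k. if i = j then z j else 0)"
    using e j by (intro sum.cong) (auto simp: unitary_def)
  finally show ?thesis using j by simp
qed

lemma herm_residual:
  assumes e: "unitary k e" and v: "v \<in> T" and j: "j < k"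
  shows "herm (v - (\<Sum>i<k. herm v (e i) \<star> e i)) (e j) = 0"
proof -
  have T: "e i \<in> T" if "i < k" for i using e that by (rule unitary_T)
  have "(\<Sum>i<k. herm v (e i) \<star> e i) \<in> T" using T by simp
  then show ?thesis
    using herm_unitary_sum[OF e j] v T[OF j] by (simp add: herm_diff)
qed

end

section \<open>Unitary frames in real dimension 2n\<close>

locale hermitian_space_dim = hermitian_space +
  fixes n :: nat
  assumes basis: "\<exists>S. finite S \<and> independent S \<and> span S = T \<and> card S = 2 * n"
begin

text \<open>A unitary family of length \<open>k\<close> realifies to \<open>2 * k\<close>
  independent vectors, and these cannot outnumber a spanning set of \<open>2 * n\<close>.\<close>

lemma unitary_le: assumes "unitary k e" shows "k \<le> n"
proof -
  obtain S where S: "finite S" "span S = T" "card S = 2 * n" using basis by auto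
  have T: "e i \<in> T" if "i < k" for i using assms that by (auto simp: unitary_def)
  define r where "r = realify e"
  have rT: "r \<in> {..<2*k} \<rightarrow> T" using T by (auto simp: r_def)
  have "orthonormal G (2 * k) r"
    using assms by (simp add: r_def unitary_frame_def flip: unitary_frame_iff)
  then have o: "inj_on r {..<2*k}" "independent (r ` {..<2*k})"
    using orthonormal_independent[OF rT] by auto
  have "r ` {..<2*k} \<subseteq> span S" using S(2) rT by auto
  then have "card (r ` {..<2*k}) \<le> card S"
    using independent_span_bound[OF S(1) o(2)] by simp
  then show ?thesis using S(3) card_image[OF o(1)] by simp
qed

text \<open>Maximality: a nonzero residual, normalized, would give a unitary family of length
  \<open>Suc n\<close>.\<close>

lemma unitary_expand:
  assumes e: "unitary n e" and v: "v \<in> T"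
  shows "(\<Sum>i<n. herm v (e i) \<star> e i) = v"
proof (rule ccontr)
  let ?r = "v - (\<Sum>i<n. herm v (e i) \<star> e i)"
  assume "\<not> ?thesis"
  then have "unitary (Suc n) (e(n := (1 / sqrt (G ?r ?r)) *\<^sub>R ?r))"
    using herm_residual[OF e v] v unitary_T[OF e] by (intro unitary_extend e) auto
  then show False using unitary_le by fastforce
qed

text \<open>As long as \<open>k < n\<close>, the expansions in the family stay in the real span of
  the \<open>2 * k\<close> vectors \<open>e i\<close> and \<open>J (e i)\<close>, which is too small
  for \<open>T\<close>; so some vector has a nonzero residual.\<close>

lemma exists_unitary_le: "k \<le> n \<Longrightarrow> \<exists>e. unitary k e"
proof (induction k)
  case 0 show ?case by (auto simp: unitary_def)
next
  case (Suc k)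
  then obtain e where e: "unitary k e" by auto
  have T: "e i \<in> T" if "i < k" for i using e that by (auto simp: unitary_def)
  obtain S where S: "finite S" "independent S" "span S = T" "card S = 2 * n" using basis by auto
  have "\<exists>v\<in>T. (\<Sum>i<k. herm v (e i) \<star> e i) \<noteq> v"
  proof (rule ccontr)
    assume "\<not> ?thesis"
    then have x: "(\<Sum>i<k. herm v (e i) \<star> e i) = v" if "v \<in> T" for v using that by auto
    have "v \<in> span (e ` {..<k} \<union> (\<lambda>i. J (e i)) ` {..<k})" if "v \<in> T" for v
    proof -
      have "(\<Sum>i<k. herm v (e i) \<star> e i) \<in> span (e ` {..<k} \<union> (\<lambda>i. J (e i)) ` {..<k})"
        unfolding cscale_def by (intro span_sum span_add span_scale span_base) auto
      then show ?thesis using x[OF that] by simp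
    qed
    then have "card S \<le> card (e ` {..<k} \<union> (\<lambda>i. J (e i)) ` {..<k})"
      using S span_superset[of S] by (intro independent_span_bound[THEN conjunct2]) auto
    also have "\<dots> \<le> k + k"
      by (rule order.trans[OF card_Un_le add_mono]) (auto intro: card_image_le[of "{..<k}", simplified])
    finally show False using S Suc by simp
  qed
  then obtain v where v: "v \<in> T" "(\<Sum>i<k. herm v (e i) \<star> e i) \<noteq> v" by auto
  then show ?case
    using unitary_extend[OF e, of "v - (\<Sum>i<k. herm v (e i) \<star> e i)"] herm_residual[OF e v(1)] T by auto
qed

lemma exists_unitary: "\<exists>e. unitary n e"
  using exists_unitary_le by auto

end


section \<open>Complex volume forms\<close>

lemma alternating_on_cong:
  "alternating_on T m \<omega> \<Longrightarrow> (\<And>i. i < m \<Longrightarrow> w i = w' i) \<Longrightarrow> \<omega> w = \<omega> w'"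
  by (auto simp: alternating_on_def)

lemma alternating_on_lincomb:
  assumes "alternating_on T m \<omega>" "w \<in> {..<m} \<rightarrow> T" "k < m" "u \<in> T" "v \<in> T"
  shows "\<omega> (w(k := a *\<^sub>R u + b *\<^sub>R v)) = a *\<^sub>R \<omega> (w(k := u)) + b *\<^sub>R \<omega> (w(k := v))"
  using assms by (auto simp: alternating_on_def)

lemma alternating_on_eq_0:
  assumes "alternating_on T m \<omega>" "w \<in> {..<m} \<rightarrow> T" "i < m" "j < m" "i \<noteq> j" "w i = w j"
  shows "\<omega> w = 0"
  using assms by (auto simp: alternating_on_def)

text \<open>Polarization: expand the vanishing value that has \<open>w i + w j\<close> in both
  slots.\<close>

lemma alternating_on_swap:
  assumes T: "real_vector.subspace T" and alt: "alternating_on T m \<omega>"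
    and w: "w \<in> {..<m} \<rightarrow> T" and ij: "i < m" "j < m" "i \<noteq> j"
  shows "\<omega> (w \<circ> Transposition.transpose i j) = - \<omega> w"
proof -
  let ?f = "\<lambda>x y. \<omega> (w(i := x, j := y))"
  have wT: "w k \<in> T" if "k < m" for k using w that by auto
  have wu: "w(k := x) \<in> {..<m} \<rightarrow> T" if "x \<in> T" for x k using w that by auto
  have addT: "x + y \<in> T" if "x \<in> T" "y \<in> T" for x y
    using T that by (rule real_vector.subspace_add)
  have eq0: "?f x x = 0" if "x \<in> T" for x
    using that ij by (intro alternating_on_eq_0[OF alt, of _ i j] wu) (use w in auto)
  have add1: "?f (x + y) z = ?f x z + ?f y z" if "x \<in> T" "y \<in> T" "z \<in> T" for x y z
    using alternating_on_lincomb[OF alt wu[OF that(3), of j] ij(1) that(1,2), of 1 1] ij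
    by (simp add: fun_upd_twist)
  have add2: "?f z (x + y) = ?f z x + ?f z y" if "x \<in> T" "y \<in> T" "z \<in> T" for x y z
    using alternating_on_lincomb[OF alt wu[OF that(3), of i] ij(2) that(1,2), of 1 1] ij
    by simp
  let ?a = "w i" and ?b = "w j"
  have ab: "?a \<in> T" "?b \<in> T" using wT ij by auto
  have "0 = ?f (?a + ?b) (?a + ?b)" using eq0 addT ab by simp
  also have "\<dots> = ?f ?a ?b + ?f ?b ?a"
    unfolding add1[OF ab addT[OF ab]] add2[OF ab ab(1)] add2[OF ab ab(2)] eq0[OF ab(1)] eq0[OF ab(2)]
    by simp
  finally have "?f ?b ?a = - \<omega> w" by (simp add: eq_neg_iff_add_eq_0 add.commute)
  moreover have "w \<circ> Transposition.transpose i j = w(i := ?b, j := ?a)"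
    using ij by (auto simp: fun_eq_iff Transposition.transpose_def)
  ultimately show ?thesis by simp
qed

text \<open>Induction over a decomposition of the permutation into transpositions; the tuple is kept
  arbitrary because each transposition is moved into it.\<close>

lemma alternating_on_permutes:
  assumes T: "real_vector.subspace T" and alt: "alternating_on T m \<omega>"
    and w: "w \<in> {..<m} \<rightarrow> T" and p: "p permutes {..<m}"
  shows "\<omega> (w \<circ> p) = of_int (sign p) *\<^sub>R \<omega> w"
  using p finite_lessThan[of m] w
proof (induction p arbitrary: w rule: permutes_induct)
  case id
  then show ?case by simp
next
  case (swap a b p)
  let ?t = "Transposition.transpose a b"
  have wt: "w \<circ> ?t \<in> {..<m} \<rightarrow> T" using swap.prems swap.hyps by (auto simp: Transposition.transpose_def)
  have "\<omega> (w \<circ> (?t \<circ> p)) = of_int (sign p) *\<^sub>R \<omega> (w \<circ> ?t)"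
    using swap.IH[OF wt] by (simp only: o_assoc)
  also have "\<omega> (w \<circ> ?t) = - \<omega> w"
    using swap by (intro alternating_on_swap[OF T alt]) auto
  finally have "\<omega> (w \<circ> (?t \<circ> p)) = of_int (sign p) *\<^sub>R - \<omega> w" .
  moreover have "sign (?t \<circ> p) = - sign p"
    using swap by (subst sign_compose) (auto simp: permutation_swap_id sign_swap_id intro: permutes_imp_permutation[OF finite_lessThan])
  ultimately show ?case by (simp only: of_int_minus scaleR_minus_left scaleR_minus_right)
qed

section \<open>Forms of type (n,0) as complex determinants\<close>

locale complex_volume = hermitian_space_dim T G J n
  for T :: "'t::real_vector set" and G J n +
  fixes \<psi> :: "(nat \<Rightarrow> 't) \<Rightarrow> complex"
  assumes n_pos: "n > 0"
    and alt: "alternating_on T n \<psi>"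
    and type_n0: "\<lbrakk>w \<in> {..<n} \<rightarrow> T; k < n\<rbrakk> \<Longrightarrow> \<psi> w + \<i> * \<psi> (w(k := J (w k))) = 0"
    and vol: "volume_form_on T G J n
        (\<lambda>w. (- 1) ^ (n * (n - 1) div 2) * (\<i> / 2) ^ n * wedge n n \<psi> (\<lambda>u. cnj (\<psi> u)) w)"
begin

lemmas psi_cong = alternating_on_cong[OF alt]

text \<open>Multiplied by the imaginary unit, the type condition says that \<open>\<psi>\<close> is
  complex linear in each slot, with \<open>J\<close> as the imaginary unit of
  \<open>T\<close>.\<close>

lemma psi_J:
  assumes "w \<in> {..<n} \<rightarrow> T" "k < n" "v \<in> T"
  shows "\<psi> (w(k := J v)) = \<i> * \<psi> (w(k := v))"
proof -
  have "\<psi> (w(k := v)) + \<i> * \<psi> (w(k := J v)) = 0"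
    using type_n0[of "w(k := v)" k] assms by (simp add: PiE_def Pi_def)
  then have "\<i> * (\<psi> (w(k := v)) + \<i> * \<psi> (w(k := J v))) = 0" by simp
  then show ?thesis by (simp add: algebra_simps)
qed

lemma psi_add:
  assumes "w \<in> {..<n} \<rightarrow> T" "k < n" "u \<in> T" "v \<in> T"
  shows "\<psi> (w(k := u + v)) = \<psi> (w(k := u)) + \<psi> (w(k := v))"
  using alternating_on_lincomb[OF alt assms, of 1 1] by simp

lemma psi_cscale:
  assumes "w \<in> {..<n} \<rightarrow> T" "k < n" "v \<in> T"
  shows "\<psi> (w(k := z \<star> v)) = z * \<psi> (w(k := v))"
proof -
  have "\<psi> (w(k := z \<star> v)) = Re z *\<^sub>R \<psi> (w(k := v)) + Im z *\<^sub>R \<psi> (w(k := J v))"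
    unfolding cscale_def by (rule alternating_on_lincomb[OF alt assms(1,2,3) J_T[OF assms(3)]])
  also have "\<dots> = z * \<psi> (w(k := v))"
    unfolding psi_J[OF assms] by (simp add: complex_eq_iff algebra_simps)
  finally show ?thesis .
qed

lemma psi_sum:
  assumes "w \<in> {..<n} \<rightarrow> T" "k < n" "\<And>j. j < m \<Longrightarrow> v j \<in> T"
  shows "\<psi> (w(k := \<Sum>j<(m::nat). z j \<star> v j)) = (\<Sum>j<m. z j * \<psi> (w(k := v j)))"
  using assms(3)
proof (induction m)
  case 0
  show ?case using psi_cscale[OF assms(1,2), of 0 0] by (simp add: fun_upd_def)
next
  case (Suc m)
  have T: "(\<Sum>j<m. z j \<star> v j) \<in> T" "v m \<in> T" using Suc.prems by auto
  have "\<psi> (w(k := \<Sum>j<Suc m. z j \<star> v j)) = \<psi> (w(k := (\<Sum>j<m. z j \<star> v j) + z m \<star> v m))"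
    by (simp only: sum.lessThan_Suc)
  also have "\<dots> = (\<Sum>j<m. z j * \<psi> (w(k := v j))) + z m * \<psi> (w(k := v m))"
    unfolding psi_add[OF assms(1,2) T(1) cscale_T[OF T(2)]] psi_cscale[OF assms(1,2) T(2)]
    using Suc.IH Suc.prems by (simp only: less_SucI)
  finally show ?case by (simp only: sum.lessThan_Suc)
qed

text \<open>Only the first \<open>k\<close> slots are expanded, and the others carry an arbitrary
  \<open>u\<close>: the induction parks the vector \<open>v j\<close> chosen for slot
  \<open>k\<close> in \<open>u\<close>. The index functions are the identity outside the expanded
  slots, so each choice is counted once and the index set is finite.\<close>

lemma psi_expand_rows:
  assumes v: "\<And>j. j < n \<Longrightarrow> v j \<in> T" and "u \<in> {..<n} \<rightarrow> T" and "k \<le> n"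
  shows "\<psi> (\<lambda>i. if i < k then \<Sum>j<n. B i j \<star> v j else u i) =
    (\<Sum>f | (\<forall>i\<in>{..<k}. f i \<in> {..<n}) \<and> (\<forall>i. i \<notin> {..<k} \<longrightarrow> f i = i).
       (\<Prod>i<k. B i (f i)) * \<psi> (\<lambda>i. if i < k then v (f i) else u i))"
  using assms(2,3)
proof (induction k arbitrary: u)
  case 0
  have *: "{f. (\<forall>i\<in>{..<0}. f i \<in> {..<n}) \<and> (\<forall>i. i \<notin> {..<0} \<longrightarrow> f i = i)} = {id :: nat \<Rightarrow> nat}"
    by (auto simp: fun_eq_iff)
  show ?case unfolding * by simp
next
  case (Suc k)
  let ?F = "\<lambda>k. {f. (\<forall>i\<in>{..<k}. f i \<in> {..<n}) \<and> (\<forall>i. i \<notin> {..<k} \<longrightarrow> f i = i)}"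
  let ?s = "\<lambda>i. \<Sum>j<n. B i j \<star> v j"
  have k: "k < n" using Suc by simp
  have sT: "?s i \<in> T" for i using v by auto
  have F: "k < n" "(\<lambda>i. if i < k then ?s i else u i) \<in> {..<n} \<rightarrow> T"
    using sT Suc.prems by auto
  have "\<psi> (\<lambda>i. if i < Suc k then ?s i else u i) = \<psi> ((\<lambda>i. if i < k then ?s i else u i)(k := ?s k))"
    by (intro arg_cong[of _ _ \<psi>]) (auto simp: fun_eq_iff less_Suc_eq)
  also have "\<dots> = (\<Sum>j<n. B k j * \<psi> ((\<lambda>i. if i < k then ?s i else u i)(k := v j)))"
    by (rule psi_sum[OF F(2,1)]) (rule v)
  also have "\<dots> = (\<Sum>j<n. B k j * \<psi> (\<lambda>i. if i < k then ?s i else (u(k := v j)) i))"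
    by (intro sum.cong refl arg_cong2[of _ _ _ _ "(*)"] arg_cong[of _ _ \<psi>]) (auto simp: fun_eq_iff)
  also have "\<dots> = (\<Sum>j<n. B k j * (\<Sum>f\<in>?F k. (\<Prod>i<k. B i (f i)) *
      \<psi> (\<lambda>i. if i < k then v (f i) else (u(k := v j)) i)))"
    using Suc.prems v k by (intro sum.cong refl arg_cong2[of _ _ _ _ "(*)"] Suc.IH) auto
  also have "\<dots> = (\<Sum>(j,f)\<in>{..<n} \<times> ?F k. B k j * ((\<Prod>i<k. B i (f i)) *
      \<psi> (\<lambda>i. if i < k then v (f i) else (u(k := v j)) i)))"
    by (simp add: sum_distrib_left sum.cartesian_product)
  also have "\<dots> = (\<Sum>f\<in>?F (Suc k). (\<Prod>i<Suc k. B i (f i)) * \<psi> (\<lambda>i. if i < Suc k then v (f i) else u i))"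
  \<comment> \<open>A choice for \<open>Suc k\<close> slots is a value at \<open>k\<close> together
    with a choice for the slots below; resetting the value at \<open>k\<close> to \<open>k\<close>
    returns to the index set of the smaller sum.\<close>
  proof (rule sum.reindex_bij_witness[where i = "\<lambda>f. (f k, f(k := k))" and j = "\<lambda>(j,f). f(k := j)"])
    fix x assume x: "x \<in> {..<n} \<times> ?F k"
    then obtain j f where jf: "x = (j, f)" "j < n" "f \<in> ?F k" by auto
    have "(\<Prod>i<k. B i ((f(k := j)) i)) = (\<Prod>i<k. B i (f i))"
      by (intro prod.cong) auto
    moreover have "(\<lambda>i. if i < Suc k then v ((f(k := j)) i) else u i)
        = (\<lambda>i. if i < k then v (f i) else (u(k := v j)) i)"
      by (auto simp: fun_eq_iff)
    ultimately show "(\<Prod>i<Suc k. B i ((case x of (j, f) \<Rightarrow> f(k := j)) i)) *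
      \<psi> (\<lambda>i. if i < Suc k then v ((case x of (j, f) \<Rightarrow> f(k := j)) i) else u i) =
      (case x of (j, f) \<Rightarrow> B k j * ((\<Prod>i<k. B i (f i)) * \<psi> (\<lambda>i. if i < k then v (f i) else (u(k := v j)) i)))"
      unfolding jf(1) prod.case by (simp add: mult_ac)
  qed (auto simp: fun_eq_iff k less_Suc_eq)
  finally show ?case .
qed

text \<open>Non-injective index functions repeat an argument and contribute zero; the surviving
  permutations contribute their sign, which leaves the Leibniz formula.\<close>

lemma psi_det:
  assumes v: "v \<in> {..<n} \<rightarrow> T" and B: "B \<in> carrier_mat n n"
  shows "\<psi> (\<lambda>i. \<Sum>j<n. (B $$ (i, j)) \<star> v j) = Determinant.det B * \<psi> v"
proof -
  let ?F = "{f. (\<forall>i\<in>{..<n}. f i \<in> {..<n}) \<and> (\<forall>i. i \<notin> {..<n} \<longrightarrow> f i = i)}"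
  have vT: "v j \<in> T" if "j < n" for j using v that by auto
  have fin: "finite ?F" by (rule finite_bounded_functions) auto
  have "\<psi> (\<lambda>i. \<Sum>j<n. (B $$ (i, j)) \<star> v j)
      = \<psi> (\<lambda>i. if i < n then \<Sum>j<n. (B $$ (i, j)) \<star> v j else v i)"
    by (rule psi_cong) simp
  also have "\<dots> = (\<Sum>f\<in>?F. (\<Prod>i<n. B $$ (i, f i)) * \<psi> (\<lambda>i. if i < n then v (f i) else v i))"
    using psi_expand_rows[of v v n "\<lambda>i j. B $$ (i, j)"] vT v by simp
  also have "\<dots> = (\<Sum>f\<in>?F. (\<Prod>i<n. B $$ (i, f i)) * \<psi> (v \<circ> f))"
    by (intro sum.cong refl arg_cong2[of _ _ _ _ "(*)"] psi_cong) auto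
  also have "\<dots> = (\<Sum>f | f permutes {..<n}. (\<Prod>i<n. B $$ (i, f i)) * \<psi> (v \<circ> f))"
  proof (rule sum.mono_neutral_right[OF fin])
    show "{f. f permutes {..<n}} \<subseteq> ?F"
      by (auto simp: permutes_not_in) (use permutes_in_image in fastforce)
    show "\<forall>f\<in>?F - {f. f permutes {..<n}}. (\<Prod>i<n. B $$ (i, f i)) * \<psi> (v \<circ> f) = 0"
    proof
      fix f assume f: "f \<in> ?F - {f. f permutes {..<n}}"
      then have "\<not> inj_on f {..<n}" by (auto dest!: inj_imp_permutes)
      then obtain i j where "i < n" "j < n" "i \<noteq> j" "f i = f j" by (auto simp: inj_on_def)
      then have "\<psi> (v \<circ> f) = 0"
        using f v by (intro alternating_on_eq_0[OF alt, of _ i j]) auto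
      then show "(\<Prod>i<n. B $$ (i, f i)) * \<psi> (v \<circ> f) = 0" by simp
    qed
  qed
  also have "\<dots> = (\<Sum>f | f permutes {..<n}. (of_int (sign f) * (\<Prod>i<n. B $$ (i, f i))) * \<psi> v)"
    by (intro sum.cong refl) (simp add: alternating_on_permutes[OF subspace_T alt v] scaleR_conv_of_real)
  also have "\<dots> = Determinant.det B * \<psi> v"
    by (simp add: det_def'[OF B] sum_distrib_right atLeast0LessThan)
  finally show ?thesis .
qed

end

section \<open>The wedge product as one large determinant\<close>

lemma prod_lessThan_add:
  fixes f :: "nat \<Rightarrow> 'a::comm_monoid_mult"
  shows "(\<Prod>i<m + k. f i) = (\<Prod>i<m. f i) * (\<Prod>i<k. f (m + i))"
  by (induction k) (simp_all add: mult.assoc)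

lemma sum_lessThan_add:
  fixes f :: "nat \<Rightarrow> 'a::comm_monoid_add"
  shows "(\<Sum>i<m + k. f i) = (\<Sum>i<m. f i) + (\<Sum>i<k. f (m + i))"
  by (induction k) (simp_all add: add.assoc)

text \<open>The two blocks are permuted by \<open>p\<close> and by the transport of \<open>q\<close>
  along \<open>(+) m\<close>. Their supports are disjoint, so the composite has the prescribed
  values on each block.\<close>

lemma permutes_shift_join:
  fixes m k :: nat
  assumes p: "p permutes {..<m}" and q: "q permutes {..<k}"
  obtains s where "s permutes {..<m + k}" "sign s = sign p * sign q"
    "\<And>i. i < m \<Longrightarrow> s i = p i" "\<And>i. i < k \<Longrightarrow> s (m + i) = m + q i"
proof
  let ?q = "map_permutation {..<k} ((+) m) q"
  have q': "?q permutes {m..<m + k}"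
    using q by (rule map_permutation_permutes[rotated])
      (auto simp: bij_betw_def inj_on_def lessThan_atLeast0)
  have inj: "inj_on ((+) m) {..<k}" by (auto simp: inj_on_def)
  have s: "?q permutes {..<m + k}" "p permutes {..<m + k}"
    using q' p by (auto intro: permutes_subset)
  then show "p \<circ> ?q permutes {..<m + k}" by (rule permutes_compose)
  show "sign (p \<circ> ?q) = sign p * sign q"
    using s by (subst sign_compose)
      (auto simp: sign_map_permutation[OF inj q] intro: permutes_imp_permutation[OF finite_lessThan])
  show "(p \<circ> ?q) i = p i" if "i < m" for i
    using permutes_not_in[OF q', of i] that by simp
  show "(p \<circ> ?q) (m + i) = m + q i" if "i < k" for i
  proof -
    have "?q (m + i) = m + q i" using inj that by (subst map_permutation_apply) auto
    moreover have "m + q i \<notin> {..<m}" by simp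
    ultimately show ?thesis using permutes_not_in[OF p, of "m + q i"] by simp
  qed
qed

text \<open>Laplace expansion along the first \<open>n\<close> columns, with repetitions. By the
  Leibniz formula for the two small determinants, each pair \<open>p\<close>, \<open>q\<close> of
  inner permutations gives a sum over \<open>\<sigma>\<close> that a block permutation absorbs into
  the large determinant; there are \<open>fact n * fact n\<close> such pairs.\<close>

lemma sum_sign_det_det:
  fixes a b :: "nat \<Rightarrow> nat \<Rightarrow> complex"
  shows "(\<Sum>\<sigma> | \<sigma> permutes {..<n + n}. of_int (sign \<sigma>) *
      Determinant.det (mat n n (\<lambda>(i,j). a (\<sigma> i) j)) * Determinant.det (mat n n (\<lambda>(i,j). b (\<sigma> (n + i)) j)))
    = fact n * fact n * Determinant.det (mat (n + n) (n + n) (\<lambda>(k,j). if j < n then a k j else b k (j - n)))"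
    (is "_ = _ * Determinant.det ?M")
proof -
  let ?P = "\<lambda>m. {p. p permutes {..<m::nat}}"
  define t where "t = (\<lambda>\<sigma>. of_int (sign \<sigma>) * ((\<Prod>j<n. a (\<sigma> j) j) * (\<Prod>j<n. b (\<sigma> (n + j)) j)))"
  \<comment> \<open>The column form of the Leibniz formula permutes row indices, which are the ones
    that \<open>\<sigma>\<close> acts on.\<close>
  have detn: "Determinant.det (mat n n (\<lambda>(i,j). f i j)) = (\<Sum>p\<in>?P n. of_int (sign p) * (\<Prod>j<n. f (p j) j))"
    for f :: "nat \<Rightarrow> nat \<Rightarrow> complex"
  proof -
    have "Determinant.det (mat n n (\<lambda>(i,j). f i j))
        = (\<Sum>p\<in>?P n. of_int (sign p) * (\<Prod>j<n. mat n n (\<lambda>(i,j). f i j) $$ (p j, j)))"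
      by (subst det_col[of _ n]) (auto simp: atLeast0LessThan)
    also have "\<dots> = (\<Sum>p\<in>?P n. of_int (sign p) * (\<Prod>j<n. f (p j) j))"
    proof (intro sum.cong refl arg_cong2[of _ _ _ _ "(*)"] prod.cong)
      fix p j assume "p \<in> ?P n" "j \<in> {..<n}"
      then have "p j < n" using permutes_in_image[of p "{..<n}" j] by auto
      then show "mat n n (\<lambda>(i,j). f i j) $$ (p j, j) = f (p j) j" using \<open>j \<in> _\<close> by simp
    qed
    finally show ?thesis .
  qed
  have detM: "Determinant.det ?M = (\<Sum>\<sigma>\<in>?P (n + n). t \<sigma>)"
  proof -
    have "Determinant.det ?M = (\<Sum>p\<in>?P (n + n). of_int (sign p) * (\<Prod>j<n + n. ?M $$ (p j, j)))"
      by (subst det_col[of _ "n + n"]) (auto simp: atLeast0LessThan)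
    also have "\<dots> = (\<Sum>p\<in>?P (n + n). t p)"
    proof (intro sum.cong refl)
      fix p assume p: "p \<in> ?P (n + n)"
      have "p j < n + n" if "j < n + n" for j
        using p that permutes_in_image[of p "{..<n + n}" j] by auto
      then have "(\<Prod>j<n. ?M $$ (p j, j)) = (\<Prod>j<n. a (p j) j)"
        "(\<Prod>j<n. ?M $$ (p (n + j), n + j)) = (\<Prod>j<n. b (p (n + j)) j)"
        by (auto intro!: prod.cong)
      then show "of_int (sign p) * (\<Prod>j<n + n. ?M $$ (p j, j)) = t p"
        by (simp add: t_def prod_lessThan_add)
    qed
    finally show ?thesis .
  qed
  have *: "(\<Sum>\<sigma>\<in>?P (n + n). of_int (sign \<sigma>) * of_int (sign p) * of_int (sign q) *
      ((\<Prod>j<n. a (\<sigma> (p j)) j) * (\<Prod>j<n. b (\<sigma> (n + q j)) j))) = Determinant.det ?M"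
    if p: "p permutes {..<n}" and q: "q permutes {..<n}" for p q
  proof -
    obtain s where s: "s permutes {..<n + n}" "sign s = sign p * sign q"
      "\<And>i. i < n \<Longrightarrow> s i = p i" "\<And>i. i < n \<Longrightarrow> s (n + i) = n + q i"
      using permutes_shift_join[OF p q] by metis
    \<comment> \<open>Right translation by the block permutation moves \<open>p\<close> and
      \<open>q\<close> inside \<open>\<sigma>\<close> and accounts for both of their signs.\<close>
    have "(\<Sum>\<sigma>\<in>?P (n + n). t \<sigma>) = (\<Sum>\<sigma>\<in>?P (n + n). t (\<sigma> \<circ> s))"
      using s(1) by (rule sum_permutations_compose_right)
    also have "\<dots> = (\<Sum>\<sigma>\<in>?P (n + n). of_int (sign \<sigma>) * of_int (sign p) * of_int (sign q) *
      ((\<Prod>j<n. a (\<sigma> (p j)) j) * (\<Prod>j<n. b (\<sigma> (n + q j)) j)))"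
    proof (intro sum.cong refl)
      fix \<sigma> assume "\<sigma> \<in> ?P (n + n)"
      then have "sign (\<sigma> \<circ> s) = sign \<sigma> * sign p * sign q"
        using s(1,2) by (subst sign_compose) (auto intro: permutes_imp_permutation[OF finite_lessThan])
      then show "t (\<sigma> \<circ> s) = of_int (sign \<sigma>) * of_int (sign p) * of_int (sign q) *
      ((\<Prod>j<n. a (\<sigma> (p j)) j) * (\<Prod>j<n. b (\<sigma> (n + q j)) j))"
        using s(3,4) by (simp add: t_def)
    qed
    finally show ?thesis using detM by simp
  qed
  have "(\<Sum>\<sigma>\<in>?P (n + n). of_int (sign \<sigma>) *
      Determinant.det (mat n n (\<lambda>(i,j). a (\<sigma> i) j)) * Determinant.det (mat n n (\<lambda>(i,j). b (\<sigma> (n + i)) j)))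
    = (\<Sum>\<sigma>\<in>?P (n + n). \<Sum>p\<in>?P n. \<Sum>q\<in>?P n. of_int (sign \<sigma>) * of_int (sign p) * of_int (sign q) *
      ((\<Prod>j<n. a (\<sigma> (p j)) j) * (\<Prod>j<n. b (\<sigma> (n + q j)) j)))"
    unfolding detn[of "\<lambda>i. a (_ i)"] detn[of "\<lambda>i. b (_ (n + i))"]
    by (simp only: mult.assoc sum_product) (simp add: sum_distrib_left mult_ac)
  also have "\<dots> = (\<Sum>p\<in>?P n. \<Sum>q\<in>?P n. \<Sum>\<sigma>\<in>?P (n + n). of_int (sign \<sigma>) * of_int (sign p) * of_int (sign q) *
      ((\<Prod>j<n. a (\<sigma> (p j)) j) * (\<Prod>j<n. b (\<sigma> (n + q j)) j)))"
    by (subst sum.swap) (intro sum.cong refl sum.swap)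
  also have "\<dots> = (\<Sum>p\<in>?P n. \<Sum>q\<in>?P n. Determinant.det ?M)"
    by (intro sum.cong refl *) auto
  also have "\<dots> = fact n * fact n * Determinant.det ?M"
    by (simp add: card_permutations[of "{..<n}" n] mult.assoc)
  finally show ?thesis .
qed

interpretation cnj: comm_ring_hom cnj
  by unfold_locales auto

context hermitian_space_dim
begin

text \<open>This identifies row and column products of coordinate matrices with hermitian products,
  and so translates between unitary frames and unitary matrices.\<close>

lemma herm_parseval:
  assumes e: "unitary n e" and u: "u \<in> T" and v: "v \<in> T"
  shows "herm u v = (\<Sum>i<n. herm u (e i) * cnj (herm v (e i)))"
proof -
  have T: "e i \<in> T" if "i < n" for i using e that by (rule unitary_T)
  have "herm u v = herm (\<Sum>i<n. herm u (e i) \<star> e i) v" by (simp only: unitary_expand[OF e u])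
  also have "\<dots> = (\<Sum>i<n. herm u (e i) * herm (e i) v)"
    using T v by (simp add: herm_sum herm_cscale)
  also have "\<dots> = (\<Sum>i<n. herm u (e i) * cnj (herm v (e i)))"
    using T v by (intro sum.cong) (auto simp: herm_cnj[of v])
  finally show ?thesis .
qed

end

context complex_volume
begin

lemma psi_coords:
  assumes e: "unitary n e" and w: "\<And>i. i < n \<Longrightarrow> w i \<in> T"
  shows "\<psi> w = Determinant.det (mat n n (\<lambda>(i,j). herm (w i) (e j))) * \<psi> e"
proof -
  have "\<psi> w = \<psi> (\<lambda>i. \<Sum>j<n. (mat n n (\<lambda>(i,j). herm (w i) (e j)) $$ (i, j)) \<star> e j)"
    using unitary_expand[OF e w] by (intro psi_cong) simp
  also have "\<dots> = Determinant.det (mat n n (\<lambda>(i,j). herm (w i) (e j))) * \<psi> e"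
    using e by (intro psi_det) (auto simp: unitary_def)
  finally show ?thesis .
qed

text \<open>For a real orthonormal basis the rows of the coordinate matrix together with its conjugate
  are orthogonal of norm \<open>\<surd>2\<close>, so the modulus of its determinant is \<open>2\<^sup>n\<close>; the sign and phase
  in the normalization do not matter.\<close>

lemma norm_psi_unitary:
  assumes e: "unitary n e"
  shows "norm (\<psi> e) = 1"
proof -
  define r where "r = realify e"
  \<comment> \<open>Coordinates of the real basis next to their conjugates: the first
    \<open>n\<close> columns come from \<open>\<psi>\<close>, the last \<open>n\<close> from its
    conjugate.\<close>
  define M where "M = mat (n + n) (n + n)
    (\<lambda>(k,j). if j < n then herm (r k) (e j) else cnj (herm (r k) (e (j - n))))"
  have eT: "e i \<in> T" if "i < n" for i using e that by (rule unitary_T)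
  have rT: "r k \<in> T" if "k < n + n" for k using that eT by (auto simp: r_def)
  have uf: "unitary_frame T G J n e" using e by (simp add: unitary_frame_iff)
  have orth: "G (r k) (r l) = (if k = l then 1 else 0)" if "k < n + n" "l < n + n" for k l
    using uf that by (auto simp: unitary_frame_def orthonormal_def r_def mult_2)
  have M: "M \<in> carrier_mat (n + n) (n + n)" by (simp add: M_def)
  have MM: "M * map_mat cnj (transpose_mat M) = 2 \<cdot>\<^sub>m 1\<^sub>m (n + n)"
  proof (rule eq_matI)
    fix k l assume "k < dim_row (2 \<cdot>\<^sub>m (1\<^sub>m (n + n) :: complex mat))" "l < dim_col (2 \<cdot>\<^sub>m (1\<^sub>m (n + n) :: complex mat))"
    then have kl: "k < n + n" "l < n + n" by auto
    have "(M * map_mat cnj (transpose_mat M)) $$ (k, l) = (\<Sum>j<n + n. M $$ (k, j) * cnj (M $$ (l, j)))"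
      using kl M by (simp add: scalar_prod_def atLeast0LessThan)
    also have "\<dots> = (\<Sum>j<n. herm (r k) (e j) * cnj (herm (r l) (e j)))
        + (\<Sum>j<n. cnj (herm (r k) (e j)) * herm (r l) (e j))"
      using kl by (subst sum_lessThan_add) (simp add: M_def)
    \<comment> \<open>Two Parseval sums, conjugate to each other; adding them leaves twice the real
      part, which is \<open>G\<close>.\<close>
    also have "\<dots> = herm (r k) (r l) + cnj (herm (r k) (r l))"
      using kl rT by (simp add: herm_parseval[OF e] mult.commute)
    also have "\<dots> = of_real (2 * G (r k) (r l))"
      by (simp add: complex_add_cnj Re_herm)
    finally show "(M * map_mat cnj (transpose_mat M)) $$ (k, l) = (2 \<cdot>\<^sub>m 1\<^sub>m (n + n)) $$ (k, l)"
      using kl orth by simp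
  qed (use M in auto)
  have "of_real ((norm (Determinant.det M))\<^sup>2) = Determinant.det M * cnj (Determinant.det M)"
    by (simp only: complex_norm_square)
  also have "cnj (Determinant.det M) = Determinant.det (map_mat cnj (transpose_mat M))"
    using det_transpose[OF M] by (simp only: cnj.hom_det)
  also have "Determinant.det M * \<dots> = Determinant.det (M * map_mat cnj (transpose_mat M))"
    using M by (subst det_mult[of _ "n + n"]) auto
  also have "\<dots> = of_real ((2 ^ n)\<^sup>2)"
    unfolding MM by (simp add: power_add power2_eq_square)
  finally have "(norm (Determinant.det M))\<^sup>2 = (2 ^ n)\<^sup>2" by (simp only: of_real_eq_iff)
  then have nM: "norm (Determinant.det M) = 2 ^ n" by (simp add: power2_eq_iff_nonneg)
  have "wedge n n \<psi> (\<lambda>u. cnj (\<psi> u)) r = \<psi> e * cnj (\<psi> e) * Determinant.det M"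
  proof -
    have *: "of_int (sign \<sigma>) * \<psi> (\<lambda>i. r (\<sigma> i)) * cnj (\<psi> (\<lambda>i. r (\<sigma> (n + i)))) =
      \<psi> e * cnj (\<psi> e) * (of_int (sign \<sigma>) * Determinant.det (mat n n (\<lambda>(i,j). herm (r (\<sigma> i)) (e j))) *
        Determinant.det (mat n n (\<lambda>(i,j). cnj (herm (r (\<sigma> (n + i))) (e j)))))"
      if "\<sigma> permutes {..<n + n}" for \<sigma>
    proof -
      have \<sigma>: "\<sigma> i < n + n" if "i < n + n" for i
        using permutes_in_image[OF \<open>\<sigma> permutes _\<close>, of i] that by auto
      have c: "cnj (Determinant.det (mat n n (\<lambda>(i,j). herm (r (\<sigma> (n + i))) (e j))))
        = Determinant.det (mat n n (\<lambda>(i,j). cnj (herm (r (\<sigma> (n + i))) (e j))))"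
        unfolding cnj.hom_det[symmetric] by (intro arg_cong[of _ _ Determinant.det]) auto
      have p1: "\<psi> (\<lambda>i. r (\<sigma> i)) = Determinant.det (mat n n (\<lambda>(i,j). herm (r (\<sigma> i)) (e j))) * \<psi> e"
        using \<sigma> rT by (intro psi_coords[OF e]) auto
      have p2: "\<psi> (\<lambda>i. r (\<sigma> (n + i))) = Determinant.det (mat n n (\<lambda>(i,j). herm (r (\<sigma> (n + i))) (e j))) * \<psi> e"
        using \<sigma> rT by (intro psi_coords[OF e]) auto
      show ?thesis unfolding p1 p2 complex_cnj_mult c by (simp add: mult_ac)
    qed
    have "wedge n n \<psi> (\<lambda>u. cnj (\<psi> u)) r = \<psi> e * cnj (\<psi> e) * (\<Sum>\<sigma> | \<sigma> permutes {..<n + n}. of_int (sign \<sigma>) *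
        Determinant.det (mat n n (\<lambda>(i,j). herm (r (\<sigma> i)) (e j))) *
        Determinant.det (mat n n (\<lambda>(i,j). cnj (herm (r (\<sigma> (n + i))) (e j))))) / (fact n * fact n)"
      unfolding wedge_def sum_distrib_left by (intro arg_cong2[of _ _ _ _ "(/)"] sum.cong refl *) auto
    also have "\<dots> = \<psi> e * cnj (\<psi> e) * Determinant.det M"
      by (subst sum_sign_det_det[of n "\<lambda>k j. herm (r k) (e j)" "\<lambda>k j. cnj (herm (r k) (e j))"])
        (simp add: M_def)
    finally show ?thesis .
  qed
  moreover have "(- 1) ^ (n * (n - 1) div 2) * (\<i> / 2) ^ n * wedge n n \<psi> (\<lambda>u. cnj (\<psi> u)) r = 1"
    using vol uf by (auto simp: volume_form_on_def r_def)
  ultimately have "norm ((- 1) ^ (n * (n - 1) div 2) * (\<i> / 2) ^ n * (\<psi> e * cnj (\<psi> e) * Determinant.det M)) = 1"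
    by simp
  \<comment> \<open>The modulus \<open>(1/2)^n\<close> of the prefactor cancels the modulus
    \<open>2^n\<close> of the determinant.\<close>
  then have "norm (\<psi> e) * norm (\<psi> e) = 1"
    by (simp add: norm_mult norm_power norm_divide nM power_divide)
  then show ?thesis by (metis norm_ge_zero real_sqrt_abs2 abs_of_nonneg real_sqrt_one)
qed

section \<open>Orthogonalization and Hadamard's inequality\<close>

lemma psi_sub_lincomb:
  assumes w: "w \<in> {..<n} \<rightarrow> T" and k: "k < n"
  shows "\<psi> (w(k := w k - (\<Sum>j<k. z j \<star> w j))) = \<psi> w"
proof -
  let ?s = "\<Sum>j<k. z j \<star> w j"
  have T: "w j \<in> T" if "j \<le> k" for j using w k that by auto
  have sT: "?s \<in> T" using T by simp
  have "\<psi> w = \<psi> (w(k := (w k - ?s) + ?s))" by simp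
  also have "\<dots> = \<psi> (w(k := w k - ?s)) + \<psi> (w(k := ?s))"
    using T sT by (intro psi_add[OF w k]) auto
  also have "\<psi> (w(k := ?s)) = (\<Sum>j<k. z j * \<psi> (w(k := w j)))"
    using T by (intro psi_sum[OF w k]) auto
  \<comment> \<open>Each summand has an earlier argument repeated in slot \<open>k\<close>.\<close>
  also have "\<dots> = 0"
  proof (intro sum.neutral ballI)
    fix j assume j: "j \<in> {..<k}"
    have "\<psi> (w(k := w j)) = 0"
      using w T j k by (intro alternating_on_eq_0[OF alt, of _ j k]) auto
    then show "z j * \<psi> (w(k := w j)) = 0" by simp
  qed
  finally show ?thesis by (simp only: add_0_right)
qed

text \<open>The hermitian Gram-Schmidt process, applied to
  unit vectors, leaves \<open>\<psi>\<close> unchanged until it rescales a vector of norm at most \<open>1\<close>.\<close>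

lemma norm_psi_partly_unitary:
  assumes "k \<le> n" "w \<in> {..<n} \<rightarrow> T" "unitary k w" "\<And>i. i < n \<Longrightarrow> G (w i) (w i) = 1"
  shows "norm (\<psi> w) \<le> 1 \<and> (norm (\<psi> w) = 1 \<longrightarrow> unitary n w)"
  using assms
\<comment> \<open>The induction runs downwards: \<open>k\<close> counts the slots already
  orthogonalized, and at \<open>k = n\<close> the family is a unitary frame.\<close>
proof (induction k arbitrary: w rule: inc_induct)
  case base
  then show ?case using norm_psi_unitary by simp
next
  case (step k w)
  note w = step.prems(1) and u = step.prems(2)
  have k: "k < n" using step by simp
  have T: "w j \<in> T" if "j < n" for j using w that by auto
  have T': "w j \<in> T" if "j < k" for j using T k that by auto
  define s where "s = (\<Sum>i<k. herm (w k) (w i) \<star> w i)"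
  define r where "r = w k - s"
  have sT: "s \<in> T" using T' by (simp add: s_def)
  have rT: "r \<in> T" using sT T k by (simp add: r_def)
  have ro: "herm r (w i) = 0" if "i < k" for i
    using herm_residual[OF u T[OF k] that] by (simp add: r_def s_def)
  have "herm r s = 0" using T' rT ro by (simp add: s_def herm_sum_right herm_cscale_right)
  then have rs: "G r s = 0" "G s r = 0" using G_sym[OF rT sT] Re_herm[of r s] by simp_all
  \<comment> \<open>Pythagoras for a unit vector. It bounds the length of the residual
    \<open>r\<close> by \<open>1\<close>, with equality only if the projection \<open>s\<close>
    vanishes.\<close>
  have "1 = G (r + s) (r + s)" using step.prems(3)[OF k] by (simp add: r_def)
  also have "\<dots> = G r r + G s s"
    using rT sT rs G_sym[of r "r + s"] G_sym[of s "r + s"] by (simp add: G_add)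
  finally have rr: "G r r + G s s = 1" by simp
  have psi_r: "\<psi> (w(k := r)) = \<psi> w" unfolding r_def s_def by (rule psi_sub_lincomb[OF w k])
  show ?case
  proof (cases "r = 0")
    case True
    \<comment> \<open>Here \<open>w k\<close> is a combination of the earlier vectors, so the case
      of equality cannot arise.\<close>
    then have "\<psi> w = 0" using psi_r psi_cscale[OF w k zero_T, of 0] by simp
    then show ?thesis by simp
  next
    case False
    define c where "c = sqrt (G r r)"
    have c: "c > 0" "c \<le> 1" using G_pos[OF rT False] G_self_nonneg[OF sT] rr by (auto simp: c_def)
    define e where "e = w(k := (1 / c) *\<^sub>R r)"
    have eu: "unitary (Suc k) e"
      unfolding e_def c_def by (rule unitary_extend[OF u rT False ro])
    have eT: "e \<in> {..<n} \<rightarrow> T" using T rT by (auto simp: e_def)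
    have "herm (e k) (e k) = 1" using unitary_herm[OF eu, of k k] by simp
    then have "G (e k) (e k) = 1" using Re_herm[of "e k" "e k"] by simp
    then have e1: "G (e i) (e i) = 1" if "i < n" for i
      using step.prems(3)[OF that] by (cases "i = k") (auto simp: e_def)
    have IH: "norm (\<psi> e) \<le> 1" "norm (\<psi> e) = 1 \<Longrightarrow> unitary n e"
      using step.IH[OF eT eu e1] by auto
    have "\<psi> w = \<psi> (w(k := of_real c \<star> ((1 / c) *\<^sub>R r)))"
      using psi_r c by simp
    also have "\<dots> = of_real c * \<psi> e"
      unfolding e_def using rT by (intro psi_cscale[OF w k]) auto
    finally have nw: "norm (\<psi> w) = c * norm (\<psi> e)" using c by (simp add: norm_mult)
    moreover have "c * norm (\<psi> e) \<le> 1 * 1" using c IH by (intro mult_mono) auto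
    ultimately have "norm (\<psi> w) \<le> 1" by simp
    moreover have "unitary n w" if 1: "norm (\<psi> w) = 1"
    proof -
      \<comment> \<open>A product of two nonnegative factors at most \<open>1\<close> equals
        \<open>1\<close> only if both do. Then the projection is zero and orthogonalization has left
        the tuple unchanged, so the unitarity of \<open>e\<close> is that of
        \<open>w\<close>.\<close>
      have "c * norm (\<psi> e) \<le> norm (\<psi> e)" "c * norm (\<psi> e) \<le> c"
        using c IH mult_right_mono[of c 1 "norm (\<psi> e)"] mult_left_mono[of "norm (\<psi> e)" 1 c] by auto
      then have ce: "c = 1" "norm (\<psi> e) = 1" using nw 1 c IH by auto
      then have "G s s = 0" using rr by (simp add: c_def)
      then have "s = 0" using G_eq_0_iff[OF sT] by simp
      then have "e = w" using ce by (simp add: e_def r_def)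
      then show ?thesis using IH ce by simp
    qed
    ultimately show ?thesis by blast
  qed
qed

text \<open>The process starts with an empty unitary family; real orthonormality supplies the unit
  lengths, and equality upgrades it to hermitian orthonormality.\<close>

lemma norm_psi_orthonormal:
  assumes "w \<in> {..<n} \<rightarrow> T" "orthonormal G n w"
  shows "norm (\<psi> w) \<le> 1" and "norm (\<psi> w) = 1 \<Longrightarrow> unitary n w"
  using norm_psi_partly_unitary[of 0 w] assms by (auto simp: unitary_def orthonormal_def)

end


section \<open>Oriented planes\<close>

text \<open>Acting by rows makes this a left action under matrix multiplication, and the restriction
  keeps tuples extensional, so that equal bases are equal functions. An oriented plane is then an
  orbit of the matrices of positive determinant.\<close>

definition frame_act :: "nat \<Rightarrow> real mat \<Rightarrow> (nat \<Rightarrow> 't::real_vector) \<Rightarrow> nat \<Rightarrow> 't" where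
  "frame_act m B w = (\<lambda>i\<in>{..<m}. \<Sum>j<m. (B $$ (i, j)) *\<^sub>R w j)"

lemma oriented_span_alt:
  "oriented_span m w = {frame_act m B w | B. B \<in> carrier_mat m m \<and> Determinant.det B > 0}"
  by (simp add: oriented_span_def frame_act_def)

lemma frame_act_mult:
  assumes A: "A \<in> carrier_mat m m" and B: "B \<in> carrier_mat m m"
  shows "frame_act m A (frame_act m B w) = frame_act m (A * B) w"
proof -
  have "(\<Sum>j<m. (A $$ (i, j)) *\<^sub>R (\<Sum>k<m. (B $$ (j, k)) *\<^sub>R w k)) = (\<Sum>k<m. ((A * B) $$ (i, k)) *\<^sub>R w k)"
    if i: "i < m" for i
  proof -
    have "(\<Sum>j<m. (A $$ (i, j)) *\<^sub>R (\<Sum>k<m. (B $$ (j, k)) *\<^sub>R w k))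
        = (\<Sum>k<m. \<Sum>j<m. (A $$ (i, j) * B $$ (j, k)) *\<^sub>R w k)"
      unfolding scaleR_sum_right scaleR_scaleR by (rule sum.swap)
    also have "\<dots> = (\<Sum>k<m. ((A * B) $$ (i, k)) *\<^sub>R w k)"
      using A B i by (intro sum.cong refl) (simp add: scalar_prod_def atLeast0LessThan scaleR_sum_left)
    finally show ?thesis .
  qed
  then show ?thesis by (auto simp: frame_act_def fun_eq_iff)
qed

lemma frame_act_one: "frame_act m (1\<^sub>m m) w = restrict w {..<m}"
proof -
  have "(\<Sum>j<m. (1\<^sub>m m $$ (i, j)) *\<^sub>R w j) = w i" if "i < m" for i
  proof -
    have "(\<Sum>j<m. (1\<^sub>m m $$ (i, j)) *\<^sub>R w j) = (\<Sum>j<m. if j = i then w i else 0)"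
      using that by (intro sum.cong) auto
    then show ?thesis using that by simp
  qed
  then show ?thesis by (auto simp: frame_act_def fun_eq_iff)
qed

lemma mat_inverse_exists:
  fixes B :: "'a::field mat"
  assumes "B \<in> carrier_mat m m" "Determinant.det B \<noteq> 0"
  obtains B' where "B' \<in> carrier_mat m m" "B * B' = 1\<^sub>m m" "B' * B = 1\<^sub>m m"
  using det_non_zero_imp_unit[OF assms, of undefined]
  by (auto simp: Units_def ring_mat_def)

lemma oriented_span_self:
  assumes "w \<in> extensional {..<m}"
  shows "w \<in> oriented_span m w"
  unfolding oriented_span_alt using frame_act_one[of m w] assms
  by (auto intro!: exI[of _ "1\<^sub>m m"] simp: extensional_restrict)

text \<open>The span is an orbit of a group, so it does not depend on the representative: one
  inclusion is closure under products, the other is the same inclusion for the inverse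
  matrix.\<close>

lemma oriented_span_frame_act:
  assumes B: "B \<in> carrier_mat m m" and d: "Determinant.det B > 0"
  shows "oriented_span m (frame_act m B w) = oriented_span m w"
proof -
  have sub: "oriented_span m (frame_act m A u) \<subseteq> oriented_span m u"
    if "A \<in> carrier_mat m m" "Determinant.det A > 0" for A and u :: "nat \<Rightarrow> 'a"
    unfolding oriented_span_alt
  proof clarify
    fix C :: "real mat" assume C: "C \<in> carrier_mat m m" "Determinant.det C > 0"
    have "Determinant.det (C * A) = Determinant.det C * Determinant.det A"
      using det_mult[OF C(1) that(1)] .
    then show "\<exists>D. frame_act m C (frame_act m A u) = frame_act m D u \<and> D \<in> carrier_mat m m \<and> 0 < Determinant.det D"
      using C that frame_act_mult[OF C(1) that(1), of u] by (intro exI[of _ "C * A"]) auto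
  qed
  obtain B' where B': "B' \<in> carrier_mat m m" "B * B' = 1\<^sub>m m" "B' * B = 1\<^sub>m m"
    using mat_inverse_exists[OF B] d by auto
  have "Determinant.det B' * Determinant.det B = 1"
    using det_mult[OF B'(1) B] B'(3) by simp
  then have d': "Determinant.det B' > 0" using d zero_less_mult_iff[of "Determinant.det B'" "Determinant.det B"] by simp
  \<comment> \<open>The inverse matrix recovers \<open>w\<close> only up to its values outside
    \<open>{..<m}\<close>, so the restriction is interposed.\<close>
  have "oriented_span m w \<subseteq> oriented_span m (restrict w {..<m})"
    unfolding oriented_span_alt frame_act_def by force
  also have "restrict w {..<m} = frame_act m B' (frame_act m B w)"
    unfolding frame_act_mult[OF B'(1) B] B'(3) frame_act_one ..
  also have "oriented_span m \<dots> \<subseteq> oriented_span m (frame_act m B w)"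
    by (rule sub[OF B'(1) d'])
  finally show ?thesis using sub[OF B d, of w] by blast
qed

text \<open>Linear independence of a tuple, in a form that is stable under \<open>frame_act\<close> by invertible
  matrices.\<close>

definition independent_tuple :: "nat \<Rightarrow> (nat \<Rightarrow> 't::real_vector) \<Rightarrow> bool" where
  "independent_tuple m w \<longleftrightarrow>
     (\<forall>C\<in>carrier_mat m m. (\<forall>i<m. frame_act m C w i = 0) \<longrightarrow> C = 0\<^sub>m m m)"

lemma frames_independent_tuple:
  assumes "w \<in> frames T m"
  shows "independent_tuple m w"
  unfolding independent_tuple_def
proof (intro ballI impI)
  fix C :: "real mat" assume C: "C \<in> carrier_mat m m" and 0: "\<forall>i<m. frame_act m C w i = 0"
  have w: "inj_on w {..<m}" "independent (w ` {..<m})" using assms by (auto simp: frames_def)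
  have "C $$ (i, j) = 0" if ij: "i < m" "j < m" for i j
  proof -
    \<comment> \<open>Independence is a statement about a set of vectors, hence about coefficients
      indexed by vectors; injectivity of \<open>w\<close> converts them from indices.\<close>
    let ?u = "\<lambda>x. C $$ (i, the_inv_into {..<m} w x)"
    have "(\<Sum>x\<in>w ` {..<m}. ?u x *\<^sub>R x) = (\<Sum>j<m. (C $$ (i, j)) *\<^sub>R w j)"
      using w(1) by (simp add: sum.reindex the_inv_into_f_f)
    also have "\<dots> = 0" using 0 ij by (simp add: frame_act_def)
    finally have "?u (w j) = 0"
      using w(2) ij by (intro real_vector.independentD[of "w ` {..<m}" "w ` {..<m}" ?u]) auto
    then show ?thesis using w(1) ij by (simp add: the_inv_into_f_f)
  qed
  then show "C = 0\<^sub>m m m" using C by (intro eq_matI) auto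
qed

lemma independent_tuple_frame_act:
  assumes w: "independent_tuple m w" and B: "B \<in> carrier_mat m m" and d: "Determinant.det B \<noteq> 0"
  shows "independent_tuple m (frame_act m B w)"
  unfolding independent_tuple_def
proof (intro ballI impI)
  fix C :: "real mat"
  assume C: "C \<in> carrier_mat m m" and 0: "\<forall>i<m. frame_act m C (frame_act m B w) i = 0"
  obtain B' where B': "B' \<in> carrier_mat m m" "B * B' = 1\<^sub>m m"
    using mat_inverse_exists[OF B d] by auto
  have "C * B = 0\<^sub>m m m"
    using w 0 B C unfolding frame_act_mult[OF C B] independent_tuple_def by auto
  then have "(C * B) * B' = 0\<^sub>m m m" using B' by simp
  then show "C = 0\<^sub>m m m" using B C B' by (simp add: assoc_mult_mat[of _ m m _ m _ m])
qed

section \<open>Orthonormal bases of oriented planes\<close>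

context hermitian_space
begin

lemma G_lincomb_lincomb:
  assumes w: "\<And>i. i < m \<Longrightarrow> w i \<in> T" and o: "orthonormal G m w"
  shows "G (\<Sum>i<m. a i *\<^sub>R w i) (\<Sum>i<m. b i *\<^sub>R w i) = (\<Sum>i<m. a i * b i)"
proof -
  have 1: "G (w i) (\<Sum>j<m. b j *\<^sub>R w j) = b i" if i: "i < m" for i
  proof -
    have "G (w i) (\<Sum>j<m. b j *\<^sub>R w j) = G (\<Sum>j<m. b j *\<^sub>R w j) (w i)"
      using w i by (intro G_sym) auto
    also have "\<dots> = (\<Sum>j<m. b j * G (w j) (w i))" using w i by (simp add: G_sum G_scaleR)
    also have "\<dots> = (\<Sum>j<m. if j = i then b i else 0)"
      using o i by (intro sum.cong) (auto simp: orthonormal_def)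
    finally show ?thesis using i by simp
  qed
  have "G (\<Sum>i<m. a i *\<^sub>R w i) (\<Sum>i<m. b i *\<^sub>R w i) = (\<Sum>i<m. a i * G (w i) (\<Sum>j<m. b j *\<^sub>R w j))"
    using w by (simp add: G_sum G_scaleR)
  also have "\<dots> = (\<Sum>i<m. a i * b i)" using 1 by (intro sum.cong) auto
  finally show ?thesis .
qed

text \<open>The change between real orthonormal bases is orthogonal, with determinant
  \<open>1\<close> or \<open>-1\<close>, and the common orientation excludes \<open>-1\<close>. It
  is why values on oriented planes do not depend on the chosen basis.\<close>

lemma orthonormal_frame_act_det:
  assumes w: "w \<in> {..<m} \<rightarrow> T" and o: "orthonormal G m w" and B: "B \<in> carrier_mat m m"
    and d: "Determinant.det B > 0" and o': "orthonormal G m (frame_act m B w)"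
  shows "Determinant.det B = 1"
proof -
  have "B * transpose_mat B = 1\<^sub>m m"
  proof (rule eq_matI)
    fix i j assume "i < dim_row (1\<^sub>m m :: real mat)" "j < dim_col (1\<^sub>m m :: real mat)"
    then have ij: "i < m" "j < m" by auto
    have "(B * transpose_mat B) $$ (i, j) = (\<Sum>k<m. B $$ (i, k) * B $$ (j, k))"
      using B ij by (simp add: scalar_prod_def atLeast0LessThan)
    also have "\<dots> = G (frame_act m B w i) (frame_act m B w j)"
      unfolding frame_act_def using w ij o by (simp add: G_lincomb_lincomb[of m w] Pi_def)
    also have "\<dots> = (1\<^sub>m m) $$ (i, j)" using o' ij by (simp add: orthonormal_def)
    finally show "(B * transpose_mat B) $$ (i, j) = (1\<^sub>m m) $$ (i, j)" .
  qed (use B in auto)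
  then have "Determinant.det B * Determinant.det B = 1"
    using det_mult[of B m "transpose_mat B"] det_transpose[OF B] B by simp
  then show ?thesis using d square_eq_1_iff by fastforce
qed

text \<open>One step of the Gram-Schmidt process is the action of a lower triangular matrix with
  positive diagonal.\<close>

lemma orthonormalize:
  assumes "k \<le> m" "w \<in> {..<m} \<rightarrow> T" "independent_tuple m w" "orthonormal G k w"
  shows "\<exists>B\<in>carrier_mat m m. Determinant.det B > 0 \<and> orthonormal G m (frame_act m B w)"
  using assms
proof (induction k arbitrary: w rule: inc_induct)
  case base
  then have "orthonormal G m (frame_act m (1\<^sub>m m) w)" by (simp add: frame_act_one orthonormal_def)
  then show ?case by (intro bexI[of _ "1\<^sub>m m"]) auto
next
  case (step k w)
  note w = step.prems(1) and ind = step.prems(2) and o = step.prems(3)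
  have k: "k < m" using step by simp
  have T: "w j \<in> T" if "j < m" for j using w that by auto
  have T': "w j \<in> T" if "j < k" for j using T k that by auto
  define s where "s = (\<Sum>i<k. G (w k) (w i) *\<^sub>R w i)"
  define r where "r = w k - s"
  have sT: "s \<in> T" using T' by (simp add: s_def)
  have rT: "r \<in> T" using sT T k by (simp add: r_def)
  \<comment> \<open>Coefficients of the residual in the original tuple; the entry \<open>1\<close>
    at \<open>k\<close> keeps them from vanishing.\<close>
  define row where "row = (\<lambda>j. if j = k then 1 else if j < k then - G (w k) (w j) else 0)"
  have row: "(\<Sum>j<m. row j *\<^sub>R w j) = r"
  proof -
    have "(\<Sum>j<m. row j *\<^sub>R w j) = (\<Sum>j<Suc k. row j *\<^sub>R w j)"
      using k by (intro sum.mono_neutral_right) (auto simp: row_def)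
    also have "\<dots> = r" by (simp add: row_def r_def s_def sum_negf)
    finally show ?thesis .
  qed
  have r0: "r \<noteq> 0"
  proof
    assume "r = 0"
    \<comment> \<open>Independence of a tuple is tested with square matrices, so the single relation
      is repeated in every row.\<close>
    let ?C = "mat m m (\<lambda>(i,j). row j)"
    have "?C = 0\<^sub>m m m"
      using ind row \<open>r = 0\<close> unfolding independent_tuple_def by (auto simp: frame_act_def)
    then have "?C $$ (k, k) = 0" using k by simp
    then show False using k by (simp add: row_def)
  qed
  have ro: "G r (w i) = 0" if i: "i < k" for i
  proof -
    have "G s (w i) = (\<Sum>j<k. G (w k) (w j) * G (w j) (w i))"
      unfolding s_def using T' i by (simp add: G_sum G_scaleR)
    also have "\<dots> = (\<Sum>j<k. if j = i then G (w k) (w i) else 0)"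
      using o i by (intro sum.cong) (auto simp: orthonormal_def)
    also have "\<dots> = G (w k) (w i)" using i by simp
    moreover have "G (r + s) (w i) = G r (w i) + G s (w i)" using rT sT T'[OF i] by (rule G_add)
    ultimately show ?thesis by (simp add: r_def)
  qed
  define c where "c = 1 / sqrt (G r r)"
  have c: "c > 0" "c * c * G r r = 1" using G_pos[OF rT r0] by (auto simp: c_def field_simps)
  \<comment> \<open>The identity matrix with row \<open>k\<close> replaced by the normalized
    residual; it is lower triangular with determinant \<open>c\<close>, which is positive, so the
    orientation is kept.\<close>
  define E where "E = mat m m (\<lambda>(i,j). if i = k then c * row j else if i = j then 1 else 0)"
  have E: "E \<in> carrier_mat m m" by (simp add: E_def)
  have "Determinant.det E = prod_list (diag_mat E)"
    by (rule det_lower_triangular[OF _ E]) (auto simp: E_def row_def)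
  also have "\<dots> = (\<Prod>i<m. E $$ (i, i))"
    using E by (simp add: prod_list_diag_prod atLeast0LessThan)
  also have "\<dots> = (\<Prod>i<m. if i = k then c else 1)"
    by (intro prod.cong refl) (simp add: E_def row_def)
  also have "\<dots> = c" using k by simp
  finally have dE: "Determinant.det E > 0" using c by simp
  let ?e = "frame_act m E w"
  have ek: "?e k = c *\<^sub>R r"
  proof -
    have "?e k = (\<Sum>j<m. (c * row j) *\<^sub>R w j)" using k by (simp add: frame_act_def E_def)
    also have "\<dots> = c *\<^sub>R r" by (simp add: row[symmetric] scaleR_sum_right)
    finally show ?thesis .
  qed
  have ei: "?e i = w i" if "i < m" "i \<noteq> k" for i
  proof -
    have "?e i = (\<Sum>j<m. (E $$ (i, j)) *\<^sub>R w j)"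
      using that by (simp add: frame_act_def)
    also have "\<dots> = (\<Sum>j<m. if j = i then w i else 0)"
      using that by (intro sum.cong refl) (auto simp: E_def)
    finally show ?thesis using that by simp
  qed
  have eT: "?e \<in> {..<m} \<rightarrow> T" using w by (auto simp: frame_act_def)
  have "orthonormal G (Suc k) ?e"
    unfolding orthonormal_def
  proof (intro allI impI)
    fix i j assume ij: "i < Suc k" "j < Suc k"
    have *: "G (w j) (c *\<^sub>R r) = 0" "G (c *\<^sub>R r) (w j) = 0" if "j < k" for j
      using ro[OF that] rT T'[OF that] G_sym[of "w j" "c *\<^sub>R r"] by (simp_all add: G_scaleR)
    have "G (c *\<^sub>R r) (c *\<^sub>R r) = 1"
      using c rT G_sym[of r "c *\<^sub>R r"] by (simp add: G_scaleR)
    then show "G (?e i) (?e j) = (if i = j then 1 else 0)"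
      using ij k o * by (cases "i = k"; cases "j = k") (auto simp: ek ei orthonormal_def)
  qed
  then obtain B where B: "B \<in> carrier_mat m m" "Determinant.det B > 0" "orthonormal G m (frame_act m B ?e)"
    using step.IH[OF eT independent_tuple_frame_act[OF ind E]] dE by auto
  then show ?case
    using det_mult[OF B(1) E] dE E unfolding frame_act_mult[OF B(1) E]
    by (intro bexI[of _ "B * E"]) auto
qed

lemma orthonormal_in_frames:
  assumes "w \<in> {..<m} \<rightarrow>\<^sub>E T" "orthonormal G m w"
  shows "w \<in> frames T m"
  using orthonormal_independent[of w m] assms by (auto simp: frames_def PiE_def)

text \<open>Unfolds the choice in \<open>eval_plane\<close>: orthonormalization shows that a choice
  exists, and the chosen tuple, being in the orbit, represents the same oriented plane.\<close>

lemma eval_plane_witness: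
  assumes "\<xi> \<in> oriented_planes T m"
  obtains w where "w \<in> {..<m} \<rightarrow>\<^sub>E T" "orthonormal G m w" "\<xi> = oriented_span m w" "eval_plane G m \<phi> \<xi> = \<phi> w"
proof -
  obtain u where u: "u \<in> frames T m" "\<xi> = oriented_span m u"
    using assms by (auto simp: oriented_planes_def)
  have uT: "u \<in> {..<m} \<rightarrow> T" using u by (auto simp: frames_def)
  obtain B where "B \<in> carrier_mat m m" "Determinant.det B > 0" "orthonormal G m (frame_act m B u)"
    using orthonormalize[OF _ uT frames_independent_tuple[OF u(1)], of 0] by (auto simp: orthonormal_def)
  then have "\<exists>w. w \<in> \<xi> \<and> orthonormal G m w" by (auto simp: u oriented_span_alt)
  then have w: "(SOME w. w \<in> \<xi> \<and> orthonormal G m w) \<in> \<xi>" "orthonormal G m (SOME w. w \<in> \<xi> \<and> orthonormal G m w)"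
    by (metis (mono_tags, lifting) someI_ex)+
  obtain C where C: "C \<in> carrier_mat m m" "Determinant.det C > 0"
    "(SOME w. w \<in> \<xi> \<and> orthonormal G m w) = frame_act m C u"
    using w(1) by (auto simp: u(2) oriented_span_alt)
  show ?thesis
  proof (rule that[of "SOME w. w \<in> \<xi> \<and> orthonormal G m w"])
    show "(SOME w. w \<in> \<xi> \<and> orthonormal G m w) \<in> {..<m} \<rightarrow>\<^sub>E T"
      unfolding C(3) frame_act_def using uT by (auto simp: Pi_def)
    show "\<xi> = oriented_span m (SOME w. w \<in> \<xi> \<and> orthonormal G m w)"
      unfolding C(3) oriented_span_frame_act[OF C(1,2)] by (rule u(2))
  qed (use w in \<open>simp_all add: eval_plane_def\<close>)
qed

end

section \<open>Calibrated planes and special unitary frames\<close>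

context complex_volume
begin

lemma psi_frame_act:
  assumes w: "w \<in> {..<n} \<rightarrow> T" and B: "B \<in> carrier_mat n n"
  shows "\<psi> (frame_act n B w) = of_real (Determinant.det B) * \<psi> w"
proof -
  have "\<psi> (frame_act n B w) = \<psi> (\<lambda>i. \<Sum>j<n. (map_mat complex_of_real B $$ (i, j)) \<star> w j)"
    using B by (intro psi_cong) (simp add: frame_act_def)
  also have "\<dots> = of_real (Determinant.det B) * \<psi> w"
    using psi_det[OF w, of "map_mat complex_of_real B"] B by simp
  finally show ?thesis .
qed

text \<open>The basis chosen by \<open>eval_plane\<close> differs from \<open>w\<close> by a real
  matrix of determinant \<open>1\<close>, which does not change \<open>\<psi>\<close>.\<close>

lemma eval_plane_Re_psi:
  assumes w: "w \<in> {..<n} \<rightarrow>\<^sub>E T" and o: "orthonormal G n w"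
  shows "eval_plane G n (\<lambda>w. Re (\<psi> w)) (oriented_span n w) = Re (\<psi> w)"
proof -
  have wT: "w \<in> {..<n} \<rightarrow> T" using w by auto
  have "oriented_span n w \<in> oriented_planes T n"
    using orthonormal_in_frames[OF w o] by (simp add: oriented_planes_def)
  then obtain u where u: "u \<in> {..<n} \<rightarrow>\<^sub>E T" "orthonormal G n u" "oriented_span n w = oriented_span n u"
    "eval_plane G n (\<lambda>w. Re (\<psi> w)) (oriented_span n w) = Re (\<psi> u)"
    by (rule eval_plane_witness)
  have "u \<in> oriented_span n w"
    unfolding u(3) using u(1) by (intro oriented_span_self) (auto simp: PiE_def)
  then obtain B where B: "B \<in> carrier_mat n n" "Determinant.det B > 0" "u = frame_act n B w"
    by (auto simp: oriented_span_alt)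
  then have "Determinant.det B = 1"
    using orthonormal_frame_act_det[OF wT o B(1,2)] u(2) by simp
  then have "\<psi> u = \<psi> w" using psi_frame_act[OF wT B(1)] B(3) by simp
  then show ?thesis using u(4) by simp
qed

lemma eval_plane_Re_psi_le:
  assumes "\<xi> \<in> oriented_planes T n"
  shows "eval_plane G n (\<lambda>w. Re (\<psi> w)) \<xi> \<le> 1"
proof -
  obtain w where w: "w \<in> {..<n} \<rightarrow>\<^sub>E T" "orthonormal G n w"
    "eval_plane G n (\<lambda>w. Re (\<psi> w)) \<xi> = Re (\<psi> w)"
    using eval_plane_witness[OF assms] by metis
  then have "norm (\<psi> w) \<le> 1" by (intro norm_psi_orthonormal) auto
  then show ?thesis using w(3) complex_Re_le_cmod[of "\<psi> w"] by linarith
qed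

lemma unitary_orthonormal: "unitary k e \<Longrightarrow> orthonormal G k e"
  unfolding unitary_def orthonormal_def by (metis Re_herm one_complex.sel(1) zero_complex.sel(1))

definition special_frames :: "(nat \<Rightarrow> 't) set" where
  "special_frames = {e \<in> {..<n} \<rightarrow>\<^sub>E T. unitary n e \<and> \<psi> e = 1}"

text \<open>These are the special Lagrangian planes of the tangent space.\<close>

definition special_planes :: "(nat \<Rightarrow> 't) set set" where
  "special_planes = {\<xi> \<in> oriented_planes T n. eval_plane G n (\<lambda>w. Re (\<psi> w)) \<xi> = 1}"

text \<open>On a plane of contact the real part of \<open>\<psi>\<close> already equals the largest
  possible modulus, so the imaginary part vanishes, and the equality case of Hadamard's inequality
  gives unitarity.\<close>

lemma special_planes_eq: "special_planes = oriented_span n ` special_frames"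
proof
  show "special_planes \<subseteq> oriented_span n ` special_frames"
  proof
    fix \<xi> assume "\<xi> \<in> special_planes"
    then have \<xi>: "\<xi> \<in> oriented_planes T n" "eval_plane G n (\<lambda>w. Re (\<psi> w)) \<xi> = 1"
      by (auto simp: special_planes_def)
    obtain w where w: "w \<in> {..<n} \<rightarrow>\<^sub>E T" "orthonormal G n w" "\<xi> = oriented_span n w" "Re (\<psi> w) = 1"
      using eval_plane_witness[OF \<xi>(1)] \<xi>(2) by metis
    have wT: "w \<in> {..<n} \<rightarrow> T" using w by auto
    have "norm (\<psi> w) \<le> 1" using wT w(2) by (rule norm_psi_orthonormal)
    then have n1: "norm (\<psi> w) = 1" using w(4) complex_Re_le_cmod[of "\<psi> w"] by linarith
    then have "(Re (\<psi> w))\<^sup>2 + (Im (\<psi> w))\<^sup>2 = 1" by (metis cmod_power2 one_power2)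
    then have "\<psi> w = 1" using w(4) by (simp add: complex_eq_iff)
    then show "\<xi> \<in> oriented_span n ` special_frames"
      using w norm_psi_orthonormal(2)[OF wT w(2) n1] by (auto simp: special_frames_def)
  qed
  show "oriented_span n ` special_frames \<subseteq> special_planes"
  proof clarify
    fix e assume "e \<in> special_frames"
    then have e: "e \<in> {..<n} \<rightarrow>\<^sub>E T" "orthonormal G n e" "\<psi> e = 1"
      by (auto simp: special_frames_def unitary_orthonormal)
    then show "oriented_span n e \<in> special_planes"
      using eval_plane_Re_psi[OF e(1,2)] orthonormal_in_frames[OF e(1,2)]
      by (auto simp: special_planes_def oriented_planes_def)
  qed
qed

lemma exists_special_frame: "\<exists>e. e \<in> special_frames"
proof -
  obtain e where e: "unitary n e" using exists_unitary by auto
  have T: "e i \<in> T" if "i < n" for i using e that by (rule unitary_T)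
  \<comment> \<open>The inverse phase of \<open>\<psi> e\<close>. It has modulus \<open>1\<close>,
    so applying it to one vector keeps the frame unitary; slot \<open>0\<close> exists because
    \<open>n\<close> is positive.\<close>
  define z where "z = cnj (\<psi> e)"
  have z: "z * cnj z = 1" "z * \<psi> e = 1"
    using norm_psi_unitary[OF e] complex_norm_square[of "\<psi> e"] by (auto simp: z_def mult.commute)
  define f where "f = restrict (e(0 := z \<star> e 0)) {..<n}"
  have eT: "e \<in> {..<n} \<rightarrow> T" using T by auto
  have "unitary n f"
    unfolding unitary_def
  proof (intro conjI allI impI)
    show "f \<in> {..<n} \<rightarrow> T" using T n_pos by (auto simp: f_def)
    fix i j assume ij: "i < n" "j < n"
    then show "herm (f i) (f j) = (if i = j then 1 else 0)"
      using T unitary_herm[OF e] z(1) n_pos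
      by (cases "i = 0"; cases "j = 0") (auto simp: f_def herm_cscale herm_cscale_right mult.commute)
  qed
  moreover have "\<psi> f = 1"
  proof -
    have "\<psi> f = \<psi> (e(0 := z \<star> e 0))" by (intro psi_cong) (simp add: f_def)
    also have "\<dots> = z * \<psi> e" using psi_cscale[OF eT n_pos, of "e 0" z] T n_pos by simp
    finally show ?thesis using z by simp
  qed
  moreover have "f \<in> {..<n} \<rightarrow>\<^sub>E T" using T n_pos by (auto simp: f_def)
  ultimately show ?thesis by (auto simp: special_frames_def)
qed

end


section \<open>The action of the special unitary group\<close>

lemma group_actionI:
  assumes G: "group G" and cl: "\<And>a x. a \<in> carrier G \<Longrightarrow> x \<in> E \<Longrightarrow> f a x \<in> E"
    and one: "\<And>x. x \<in> E \<Longrightarrow> f \<one>\<^bsub>G\<^esub> x = x"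
    and mult: "\<And>a b x. a \<in> carrier G \<Longrightarrow> b \<in> carrier G \<Longrightarrow> x \<in> E \<Longrightarrow> f (a \<otimes>\<^bsub>G\<^esub> b) x = f a (f b x)"
  shows "group_action G E (\<lambda>a. restrict (f a) E)"
proof -
  interpret G: group G by (rule G)
  have bij: "restrict (f a) E \<in> Bij E" if a: "a \<in> carrier G" for a
  proof -
    have "bij_betw (restrict (f a) E) E E"
    proof (rule bij_betw_byWitness[where f' = "f (inv\<^bsub>G\<^esub> a)"])
      show "\<forall>x\<in>E. f (inv\<^bsub>G\<^esub> a) (restrict (f a) E x) = x"
        using a mult[of "inv\<^bsub>G\<^esub> a" a] one by simp
      show "\<forall>x\<in>E. restrict (f a) E (f (inv\<^bsub>G\<^esub> a) x) = x"
        using a mult[of a "inv\<^bsub>G\<^esub> a"] one cl by simp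
    qed (use a cl in auto)
    then show ?thesis by (simp add: Bij_def)
  qed
  have "(\<lambda>a. restrict (f a) E) \<in> hom G (BijGroup E)"
  proof (rule homI)
    fix a b assume ab: "a \<in> carrier G" "b \<in> carrier G"
    then show "restrict (f (a \<otimes>\<^bsub>G\<^esub> b)) E = restrict (f a) E \<otimes>\<^bsub>BijGroup E\<^esub> restrict (f b) E"
      using bij cl by (auto simp: BijGroup_def compose_def fun_eq_iff mult)
  qed (use bij in \<open>simp add: BijGroup_def\<close>)
  then show ?thesis
    using G group_BijGroup by (intro group_action.intro group_hom.intro group_hom_axioms.intro)
qed

text \<open>Orbit-stabilizer theorem, pulled back along \<open>\<Phi>\<close>: the left cosets of
  \<open>H\<close> are the fibres of the orbit map \<open>f\<close>, so \<open>f\<close> descends to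
  a bijection onto the orbit, which is all of \<open>E\<close> by transitivity.\<close>

lemma homogeneous_space_isoI:
  assumes G: "group G" and iso: "\<Phi> \<in> iso G K" and act: "group_action K E act" and x: "x \<in> E"
    and trans: "\<And>y. y \<in> E \<Longrightarrow> \<exists>k\<in>carrier K. act k x = y"
    and H: "H = {a \<in> carrier G. act (\<Phi> a) x = x}"
  shows "\<exists>F. homogeneous_space_iso G H K E act \<Phi> F"
proof -
  interpret G: group G by (rule G)
  interpret act: group_action K E act by (rule act)
  interpret K: group K using act.group_hom by (rule group_hom.axioms)
  interpret \<Phi>: group_hom G K \<Phi>
    using iso by unfold_locales (simp add: iso_def)
  have bij: "bij_betw \<Phi> (carrier G) (carrier K)" using iso by (simp add: iso_def)
  define f where "f = (\<lambda>a. act (\<Phi> a) x)"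
  have fE: "f a \<in> E" if "a \<in> carrier G" for a
    using act.element_image[OF \<Phi>.hom_closed[OF that] x refl] by (simp add: f_def)
  have f_mult: "f (a \<otimes>\<^bsub>G\<^esub> b) = act (\<Phi> a) (f b)" if "a \<in> carrier G" "b \<in> carrier G" for a b
    using that x by (simp add: f_def act.composition_rule)
  have f_one: "f \<one>\<^bsub>G\<^esub> = x"
    using x by (simp add: f_def flip: act.id_eq_one)
  have inv_act: "act (\<Phi> (inv\<^bsub>G\<^esub> a)) (act (\<Phi> a) y) = y" if "a \<in> carrier G" "y \<in> E" for a y
    using act.orbit_sym_aux[of "\<Phi> a" y] that by simp
  have H': "h \<in> H \<longleftrightarrow> h \<in> carrier G \<and> f h = x" for h by (auto simp: H f_def)
  have sub: "subgroup H G"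
  proof (rule G.subgroupI)
    show "H \<subseteq> carrier G" using H' by auto
    show "H \<noteq> {}" using f_one H'[of "\<one>\<^bsub>G\<^esub>"] by auto
    show "inv\<^bsub>G\<^esub> a \<in> H" if "a \<in> H" for a
      using that inv_act[of a x] x H'[of a] H'[of "inv\<^bsub>G\<^esub> a"] by (simp add: f_def)
    show "a \<otimes>\<^bsub>G\<^esub> b \<in> H" if "a \<in> H" "b \<in> H" for a b
      using that f_mult[of a b] by (auto simp: H' f_def)
  qed
  have coset: "l_coset G a H = {b \<in> carrier G. f b = f a}" if a: "a \<in> carrier G" for a
  proof
    show "l_coset G a H \<subseteq> {b \<in> carrier G. f b = f a}"
    proof
      fix b assume "b \<in> l_coset G a H"
      then obtain h where h: "h \<in> carrier G" "f h = x" "b = a \<otimes>\<^bsub>G\<^esub> h"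
        by (auto simp: l_coset_def H')
      have "f b = f a" using f_mult[OF a h(1)] h(2,3) by (simp add: f_def)
      then show "b \<in> {b \<in> carrier G. f b = f a}" using a h by simp
    qed
    show "{b \<in> carrier G. f b = f a} \<subseteq> l_coset G a H"
    proof clarify
      fix b assume b: "b \<in> carrier G" "f b = f a"
      have "f (inv\<^bsub>G\<^esub> a \<otimes>\<^bsub>G\<^esub> b) = x"
        using f_mult[of "inv\<^bsub>G\<^esub> a" b] inv_act[OF a x] a b by (simp add: f_def)
      then have "inv\<^bsub>G\<^esub> a \<otimes>\<^bsub>G\<^esub> b \<in> H" using a b by (simp add: H')
      moreover have "b = a \<otimes>\<^bsub>G\<^esub> (inv\<^bsub>G\<^esub> a \<otimes>\<^bsub>G\<^esub> b)"
        using a b by (simp flip: G.m_assoc)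
      ultimately show "b \<in> l_coset G a H" by (auto simp: l_coset_def)
    qed
  qed
  \<comment> \<open>A representative is chosen arbitrarily; since cosets are fibres of
    \<open>f\<close>, the value does not depend on it.\<close>
  define F where "F = (\<lambda>Q. f (SOME a. a \<in> Q))"
  have F: "F (l_coset G a H) = f a" if a: "a \<in> carrier G" for a
  proof -
    have "a \<in> l_coset G a H" using a by (simp add: coset)
    then have "(SOME b. b \<in> l_coset G a H) \<in> l_coset G a H" by (rule someI)
    then show ?thesis unfolding F_def by (simp add: coset[OF a])
  qed
  have "bij_betw F (LCOSETS G H) E"
  proof (rule bij_betw_imageI)
    show "inj_on F (LCOSETS G H)"
    proof (rule inj_onI)
      fix P Q assume "P \<in> LCOSETS G H" "Q \<in> LCOSETS G H" "F P = F Q"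
      then obtain a b where "a \<in> carrier G" "b \<in> carrier G" "P = l_coset G a H" "Q = l_coset G b H"
        and "f a = f b"
        by (auto simp: LCOSETS_def F)
      then show "P = Q" by (simp add: coset)
    qed
    show "F ` LCOSETS G H = E"
    proof
      show "F ` LCOSETS G H \<subseteq> E" by (auto simp: LCOSETS_def F fE)
      show "E \<subseteq> F ` LCOSETS G H"
      proof
        fix y assume "y \<in> E"
        then obtain k where k: "k \<in> carrier K" "act k x = y" using trans by auto
        have "k \<in> \<Phi> ` carrier G" using bij k(1) by (simp add: bij_betw_def)
        then obtain a where "k = \<Phi> a" "a \<in> carrier G" by (rule imageE)
        then have "a \<in> carrier G" "f a = y" using k by (simp_all add: f_def)
        then show "y \<in> F ` LCOSETS G H" by (auto simp: LCOSETS_def F intro!: image_eqI[of _ F "l_coset G a H"])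
      qed
    qed
  qed
  moreover have "F (l_coset G a Q) = act (\<Phi> a) (F Q)" if a: "a \<in> carrier G" and Q: "Q \<in> LCOSETS G H" for a Q
  proof -
    obtain b where b: "b \<in> carrier G" "Q = l_coset G b H" using Q by (auto simp: LCOSETS_def)
    have "l_coset G a Q = l_coset G (a \<otimes>\<^bsub>G\<^esub> b) H"
      unfolding b(2) using a b(1) by (intro G.lcos_m_assoc) (auto simp: H)
    then show ?thesis using a b F f_mult by simp
  qed
  ultimately have "homogeneous_space_iso G H K E act \<Phi> F"
    using iso sub by (simp add: homogeneous_space_iso_def)
  then show ?thesis by blast
qed

section \<open>Adjoints and the matrix group SU(n)\<close>

lemma mat_adjoint_index:
  "\<lbrakk>A \<in> carrier_mat n n; i < n; j < n\<rbrakk> \<Longrightarrow> mat_adjoint A $$ (i, j) = cnj (A $$ (j, i))"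
  by (auto simp: mat_adjoint_def mat_of_rows_def)

lemma mat_adjoint_carrier [simp]:
  "A \<in> carrier_mat n n \<Longrightarrow> mat_adjoint A \<in> carrier_mat n n"
  by (auto simp: mat_adjoint_def)

lemma mat_adjoint_alt: "A \<in> carrier_mat n n \<Longrightarrow> mat_adjoint A = map_mat cnj (transpose_mat A)"
  by (intro eq_matI) (auto simp: mat_adjoint_index mat_adjoint_def mat_of_rows_def)

lemma det_mat_adjoint:
  assumes "A \<in> carrier_mat n n"
  shows "Determinant.det (mat_adjoint A) = cnj (Determinant.det A)"
  using det_transpose[OF assms] by (simp add: mat_adjoint_alt[OF assms])

lemma mat_adjoint_mult:
  assumes A: "A \<in> carrier_mat n n" and B: "B \<in> carrier_mat n n"
  shows "mat_adjoint (A * B) = mat_adjoint B * mat_adjoint (A :: complex mat)"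
proof -
  have "mat_adjoint (A * B) = map_mat cnj (transpose_mat B * transpose_mat A)"
    using A B by (simp add: mat_adjoint_alt[of _ n] transpose_mult[OF A B])
  also have "\<dots> = map_mat cnj (transpose_mat B) * map_mat cnj (transpose_mat A)"
    using A B by (intro cnj.mat_hom_mult) auto
  finally show ?thesis using A B by (simp add: mat_adjoint_alt[of _ n])
qed

lemma mat_adjoint_adjoint: "A \<in> carrier_mat n n \<Longrightarrow> mat_adjoint (mat_adjoint A) = (A :: complex mat)"
  by (intro eq_matI) (auto simp: mat_adjoint_alt[of _ n])

lemma map_mat_of_real_mult:
  assumes "A \<in> carrier_mat n n" "B \<in> carrier_mat n n"
  shows "map_mat complex_of_real (A * B) = map_mat complex_of_real A * map_mat complex_of_real B"
  using assms by (rule of_real_hom.mat_hom_mult)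

lemma SU_mat_carrier:
  "B \<in> carrier (SU_mat n) \<longleftrightarrow>
     B \<in> carrier_mat n n \<and> B * mat_adjoint B = 1\<^sub>m n \<and> Determinant.det B = 1"
  by (simp add: SU_mat_def)

lemma SU_mat_adjoint_left:
  assumes "B \<in> carrier (SU_mat n)"
  shows "mat_adjoint B * B = 1\<^sub>m n"
  using mat_mult_left_right_inverse[of B n "mat_adjoint B"] assms by (auto simp: SU_mat_carrier)

lemma SU_mat_adjoint:
  assumes B: "B \<in> carrier (SU_mat n)"
  shows "mat_adjoint B \<in> carrier (SU_mat n)"
  using assms SU_mat_adjoint_left[OF B] by (auto simp: SU_mat_carrier mat_adjoint_adjoint det_mat_adjoint)

lemma group_SU_mat: "group (SU_mat n)"
proof (rule groupI)
  fix A B assume AB: "A \<in> carrier (SU_mat n)" "B \<in> carrier (SU_mat n)"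
  then have c: "A \<in> carrier_mat n n" "B \<in> carrier_mat n n" by (auto simp: SU_mat_carrier)
  have "A * B * mat_adjoint (A * B) = A * (B * mat_adjoint B) * mat_adjoint A"
  proof -
    have c': "mat_adjoint A \<in> carrier_mat n n" "mat_adjoint B \<in> carrier_mat n n" using c by simp_all
    have "A * B * (mat_adjoint B * mat_adjoint A) = A * B * mat_adjoint B * mat_adjoint A"
      using c c' by (intro assoc_mult_mat[of _ n n _ n _ n, symmetric]) auto
    also have "A * B * mat_adjoint B = A * (B * mat_adjoint B)"
      using c c' by (intro assoc_mult_mat[of _ n n _ n _ n]) auto
    finally show ?thesis by (simp only: mat_adjoint_mult[OF c])
  qed
  also have "\<dots> = 1\<^sub>m n" using AB c by (simp add: SU_mat_carrier)
  finally show "A \<otimes>\<^bsub>SU_mat n\<^esub> B \<in> carrier (SU_mat n)"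
    using AB c det_mult[OF c] by (simp add: SU_mat_def)
next
  show "\<one>\<^bsub>SU_mat n\<^esub> \<in> carrier (SU_mat n)"
    by (auto simp: SU_mat_def mat_adjoint_alt[of _ n])
next
  fix A B C assume "A \<in> carrier (SU_mat n)" "B \<in> carrier (SU_mat n)" "C \<in> carrier (SU_mat n)"
  then show "A \<otimes>\<^bsub>SU_mat n\<^esub> B \<otimes>\<^bsub>SU_mat n\<^esub> C = A \<otimes>\<^bsub>SU_mat n\<^esub> (B \<otimes>\<^bsub>SU_mat n\<^esub> C)"
    by (auto simp: SU_mat_def assoc_mult_mat[of _ n n _ n _ n])
next
  fix A assume A: "A \<in> carrier (SU_mat n)"
  then show "\<one>\<^bsub>SU_mat n\<^esub> \<otimes>\<^bsub>SU_mat n\<^esub> A = A" by (auto simp: SU_mat_def)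
  show "\<exists>B\<in>carrier (SU_mat n). B \<otimes>\<^bsub>SU_mat n\<^esub> A = \<one>\<^bsub>SU_mat n\<^esub>"
    using SU_mat_adjoint[OF A] SU_mat_adjoint_left[OF A]
    by (intro bexI[of _ "mat_adjoint A"]) (simp_all add: SU_mat_def)
qed

section \<open>Isometries preserving the complex structure and the volume form\<close>

context complex_volume
begin

abbreviation "SU \<equiv> SU_group T G J n \<psi>"

text \<open>For unitary frames this is the complex linear map carrying \<open>e\<close> to
  \<open>e'\<close>. It is cut off outside \<open>T\<close> because members of \<open>Bij T\<close>
  are extensional.\<close>

definition frame_map :: "(nat \<Rightarrow> 't) \<Rightarrow> (nat \<Rightarrow> 't) \<Rightarrow> 't \<Rightarrow> 't" where
  "frame_map e e' = (\<lambda>v\<in>T. \<Sum>i<n. herm v (e i) \<star> e' i)"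

lemma SU_iff: "h \<in> carrier SU \<longleftrightarrow> h \<in> Bij T \<and> linear_endo_on T h \<and>
    (\<forall>u\<in>T. \<forall>v\<in>T. G (h u) (h v) = G u v) \<and> (\<forall>v\<in>T. h (J v) = J (h v)) \<and>
    (\<forall>w \<in> {..<n} \<rightarrow> T. \<psi> (\<lambda>i. h (w i)) = \<psi> w)"
  by (auto simp: SU_group_def)

lemma SU_mult: "g \<in> carrier SU \<Longrightarrow> h \<in> carrier SU \<Longrightarrow> g \<otimes>\<^bsub>SU\<^esub> h = compose T g h"
  by (simp add: SU_group_def BijGroup_def)

lemma SU_one: "\<one>\<^bsub>SU\<^esub> = (\<lambda>v\<in>T. v)"
  by (simp add: SU_group_def BijGroup_def)

lemma SU_T: "h \<in> carrier SU \<Longrightarrow> v \<in> T \<Longrightarrow> h v \<in> T"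
  using Bij_imp_funcset by (fastforce simp: SU_iff)

lemma SU_cscale:
  assumes "h \<in> carrier SU" "v \<in> T"
  shows "h (z \<star> v) = z \<star> h v"
  using assms unfolding cscale_def SU_iff linear_endo_on_def by auto

lemma SU_add:
  assumes "h \<in> carrier SU" "u \<in> T" "v \<in> T"
  shows "h (u + v) = h u + h v"
proof -
  have "h (1 *\<^sub>R u + 1 *\<^sub>R v) = 1 *\<^sub>R h u + 1 *\<^sub>R h v"
    using assms unfolding SU_iff linear_endo_on_def by blast
  then show ?thesis by simp
qed

lemma SU_sum:
  assumes "h \<in> carrier SU" "\<And>i. i < m \<Longrightarrow> f i \<in> T"
  shows "h (\<Sum>i<(m::nat). z i \<star> f i) = (\<Sum>i<m. z i \<star> h (f i))"
  using assms(2)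
proof (induction m)
  case 0
  show ?case using SU_cscale[OF assms(1), of 0 0] by simp
next
  case (Suc m)
  have "h ((\<Sum>i<m. z i \<star> f i) + z m \<star> f m) = h (\<Sum>i<m. z i \<star> f i) + h (z m \<star> f m)"
    using Suc.prems by (intro SU_add[OF assms(1)]) auto
  then show ?case using Suc by (simp add: SU_cscale[OF assms(1)])
qed

lemma SU_herm:
  assumes "h \<in> carrier SU" "u \<in> T" "v \<in> T"
  shows "herm (h u) (h v) = herm u v"
proof -
  have "J (h v) = h (J v)" "G (h u) (h (J v)) = G u (J v)" "G (h u) (h v) = G u v"
    using assms J_T[OF assms(3)] unfolding SU_iff by (metis, blast+)
  then show ?thesis by (simp add: herm_def)
qed

lemma SU_psi: "h \<in> carrier SU \<Longrightarrow> w \<in> {..<n} \<rightarrow> T \<Longrightarrow> \<psi> (\<lambda>i. h (w i)) = \<psi> w"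
  by (auto simp: SU_iff)

lemma SU_unitary:
  assumes "h \<in> carrier SU" "unitary n e"
  shows "unitary n (\<lambda>i. h (e i))"
  using assms unitary_T[OF assms(2)] by (auto simp: unitary_def SU_T SU_herm)

lemma unitary_expand_map:
  assumes h: "h \<in> carrier SU" and e: "unitary n e" and v: "v \<in> T"
  shows "h v = (\<Sum>i<n. herm v (e i) \<star> h (e i))"
proof -
  have "h v = h (\<Sum>i<n. herm v (e i) \<star> e i)" using unitary_expand[OF e v] by simp
  also have "\<dots> = (\<Sum>i<n. herm v (e i) \<star> h (e i))"
    using unitary_T[OF e] by (rule SU_sum[OF h])
  finally show ?thesis .
qed

text \<open>The uniqueness half of simple transitivity on frames: inside \<open>T\<close> by
  expansion in the frame, outside because both maps are extensional.\<close>

lemma SU_ext: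
  assumes h: "h \<in> carrier SU" and g: "g \<in> carrier SU" and e: "unitary n e"
    and eq: "\<And>i. i < n \<Longrightarrow> h (e i) = g (e i)"
  shows "h = g"
proof
  fix v
  show "h v = g v"
  proof (cases "v \<in> T")
    case True
    then show ?thesis
      using unitary_expand_map[OF h e True] unitary_expand_map[OF g e True] eq by simp
  next
    case False
    then show ?thesis
      using h g by (auto simp: SU_iff Bij_def extensional_def)
  qed
qed

lemma frame_map_T: "unitary n e' \<Longrightarrow> v \<in> T \<Longrightarrow> frame_map e e' v \<in> T"
  using unitary_T by (auto simp: frame_map_def)

lemma herm_frame_map:
  "\<lbrakk>unitary n e'; v \<in> T; j < n\<rbrakk> \<Longrightarrow> herm (frame_map e e' v) (e' j) = herm v (e j)"
  using herm_unitary_sum[of n e' j "\<lambda>i. herm v (e i)"] by (simp add: frame_map_def)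

lemma frame_map_frame:
  assumes e: "unitary n e" and e': "unitary n e'" and j: "j < n"
  shows "frame_map e e' (e j) = e' j"
proof -
  have "frame_map e e' (e j) = (\<Sum>i<n. herm (e j) (e i) \<star> e' i)"
    using unitary_T[OF e j] by (simp add: frame_map_def)
  also have "\<dots> = (\<Sum>i<n. if i = j then e' j else 0)"
    using unitary_herm[OF e j] by (intro sum.cong refl) auto
  finally show ?thesis using j by simp
qed

lemma frame_map_inverse:
  assumes e: "unitary n e" and e': "unitary n e'" and v: "v \<in> T"
  shows "frame_map e' e (frame_map e e' v) = v"
proof -
  have "frame_map e' e (frame_map e e' v) = (\<Sum>i<n. herm (frame_map e e' v) (e' i) \<star> e i)"
    using frame_map_T[OF e' v] by (simp add: frame_map_def[of e' e])
  also have "\<dots> = (\<Sum>i<n. herm v (e i) \<star> e i)"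
    by (intro sum.cong refl) (simp add: herm_frame_map[OF e' v])
  finally show ?thesis using unitary_expand[OF e v] by simp
qed

text \<open>The coordinates of the image in \<open>e'\<close> are those of the argument in
  \<open>e\<close>. Hence Parseval in both frames preserves \<open>herm\<close>, and
  \<open>\<psi>\<close> has the same coordinate determinant on both sides, multiplied by the equal
  constants \<open>\<psi> e\<close> and \<open>\<psi> e'\<close>.\<close>

lemma frame_map_SU:
  assumes e: "unitary n e" and e': "unitary n e'" and eq: "\<psi> e = \<psi> e'"
  shows "frame_map e e' \<in> carrier SU"
proof -
  let ?h = "frame_map e e'"
  note eT = unitary_T[OF e] and eT' = unitary_T[OF e']
  have hT: "?h v \<in> T" if "v \<in> T" for v using frame_map_T[OF e' that] .
  have herm: "herm (?h u) (?h v) = herm u v" if "u \<in> T" "v \<in> T" for u v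
    unfolding herm_parseval[OF e' hT[OF that(1)] hT[OF that(2)]] herm_parseval[OF e that]
    using that by (intro sum.cong refl) (simp add: herm_frame_map[OF e'])
  have add: "?h (u + v) = ?h u + ?h v" if "u \<in> T" "v \<in> T" for u v
    using that eT by (simp add: frame_map_def herm_add cscale_add_left sum.distrib)
  have scale: "?h (z \<star> v) = z \<star> ?h v" if "v \<in> T" for v z
    using that eT eT' by (simp add: frame_map_def herm_cscale cscale_sum_right cscale_cscale)
  have scaleR: "?h (r *\<^sub>R v) = r *\<^sub>R ?h v" if "v \<in> T" for v r
    using scale[OF that, of "of_real r"] by simp
  have "bij_betw ?h T T"
    using frame_map_inverse[OF e e'] frame_map_inverse[OF e' e] frame_map_T[OF e] frame_map_T[OF e']
    by (intro bij_betw_byWitness[where f' = "frame_map e' e"]) auto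
  then have "?h \<in> Bij T" by (simp add: Bij_def frame_map_def)
  moreover have "linear_endo_on T ?h"
    using hT by (auto simp: linear_endo_on_def add scaleR)
  moreover have "G (?h u) (?h v) = G u v" if "u \<in> T" "v \<in> T" for u v
    using herm[OF that] Re_herm by metis
  moreover have "?h (J v) = J (?h v)" if "v \<in> T" for v
    using scale[OF that, of \<i>] by (simp add: cscale_i)
  moreover have "\<psi> (\<lambda>i. ?h (w i)) = \<psi> w" if w: "w \<in> {..<n} \<rightarrow> T" for w
  proof -
    have wT: "w i \<in> T" if "i < n" for i using w that by auto
    have "\<psi> (\<lambda>i. ?h (w i)) = Determinant.det (mat n n (\<lambda>(i,j). herm (?h (w i)) (e' j))) * \<psi> e'"
      using hT wT by (intro psi_coords[OF e']) auto
    also have "mat n n (\<lambda>(i,j). herm (?h (w i)) (e' j)) = mat n n (\<lambda>(i,j). herm (w i) (e j))"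
      using wT by (intro cong_mat) (auto simp: herm_frame_map[OF e'])
    also have "Determinant.det \<dots> * \<psi> e' = \<psi> w"
      unfolding eq[symmetric] using wT by (intro psi_coords[OF e, symmetric]) auto
    finally show ?thesis .
  qed
  ultimately show ?thesis by (auto simp: SU_iff)
qed

lemma SU_compose:
  assumes g: "g \<in> carrier SU" and h: "h \<in> carrier SU"
  shows "compose T g h \<in> carrier SU"
proof -
  have hT: "h v \<in> T" if "v \<in> T" for v using SU_T[OF h that] .
  have "linear_endo_on T (compose T g h)"
    unfolding linear_endo_on_def
  proof (intro conjI ballI allI)
    show "compose T g h \<in> T \<rightarrow> T" using hT SU_T[OF g] by (auto simp: compose_def)
    fix u v a b assume uv: "u \<in> T" "v \<in> T"
    have "h (a *\<^sub>R u + b *\<^sub>R v) = a *\<^sub>R h u + b *\<^sub>R h v"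
      using h uv unfolding SU_iff linear_endo_on_def by blast
    moreover have "g (a *\<^sub>R h u + b *\<^sub>R h v) = a *\<^sub>R g (h u) + b *\<^sub>R g (h v)"
      using g hT[OF uv(1)] hT[OF uv(2)] unfolding SU_iff linear_endo_on_def by blast
    ultimately show "compose T g h (a *\<^sub>R u + b *\<^sub>R v) = a *\<^sub>R compose T g h u + b *\<^sub>R compose T g h v"
      using uv by (simp add: compose_def)
  qed
  moreover have "\<psi> (\<lambda>i. compose T g h (w i)) = \<psi> w" if w: "w \<in> {..<n} \<rightarrow> T" for w
  proof -
    have "\<psi> (\<lambda>i. compose T g h (w i)) = \<psi> (\<lambda>i. g (h (w i)))"
      using w by (intro psi_cong) (auto simp: compose_def)
    also have "\<dots> = \<psi> (\<lambda>i. h (w i))" using w hT by (intro SU_psi[OF g]) auto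
    also have "\<dots> = \<psi> w" using w by (rule SU_psi[OF h])
    finally show ?thesis .
  qed
  moreover have "compose T g h \<in> Bij T" using g h by (intro compose_Bij) (auto simp: SU_iff)
  moreover have "\<forall>u\<in>T. \<forall>v\<in>T. G (compose T g h u) (compose T g h v) = G u v"
    using g h hT by (auto simp: compose_def SU_iff)
  moreover have "\<forall>v\<in>T. compose T g h (J v) = J (compose T g h v)"
    using g h hT by (auto simp: compose_def SU_iff)
  ultimately show ?thesis unfolding SU_iff by blast
qed

text \<open>For inverses: an element \<open>h\<close> is the frame map from \<open>e\<close> to its
  image under \<open>h\<close>, so its inverse is the frame map in the other direction, which
  already belongs to the group.\<close>

lemma group_SU: "group SU"
proof -
  interpret B: group "BijGroup T" by (rule group_BijGroup)
  have "subgroup (carrier SU) (BijGroup T)"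
  proof (rule B.subgroupI)
    show "carrier SU \<subseteq> carrier (BijGroup T)" by (auto simp: SU_iff BijGroup_def)
    obtain e where e: "unitary n e" using exists_unitary by auto
    show "carrier SU \<noteq> {}" using frame_map_SU[OF e e] by auto
    show "inv\<^bsub>BijGroup T\<^esub> h \<in> carrier SU" if h: "h \<in> carrier SU" for h
    proof -
      let ?f = "\<lambda>i. h (e i)"
      have f: "unitary n ?f" by (rule SU_unitary[OF h e])
      have "\<psi> ?f = \<psi> e" using unitary_T[OF e] by (intro SU_psi[OF h]) auto
      then have k: "frame_map ?f e \<in> carrier SU" by (intro frame_map_SU f e)
      have "h = frame_map e ?f"
        using SU_ext[OF h frame_map_SU[OF e f] e] frame_map_frame[OF e f] \<open>\<psi> ?f = \<psi> e\<close> by simp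
      then have "frame_map ?f e (h v) = v" if "v \<in> T" for v
        using frame_map_inverse[OF e f that] by simp
      then have "frame_map ?f e \<otimes>\<^bsub>BijGroup T\<^esub> h = \<one>\<^bsub>BijGroup T\<^esub>"
        using h k by (auto simp: SU_iff BijGroup_def compose_def)
      then have "inv\<^bsub>BijGroup T\<^esub> h = frame_map ?f e"
        using h k by (intro B.inv_equality) (auto simp: SU_iff BijGroup_def)
      then show ?thesis using k by simp
    qed
    show "g \<otimes>\<^bsub>BijGroup T\<^esub> h \<in> carrier SU" if "g \<in> carrier SU" "h \<in> carrier SU" for g h
      using SU_compose[OF that] that by (auto simp: BijGroup_def SU_iff)
  qed
  then have "group (BijGroup T\<lparr>carrier := carrier SU\<rparr>)"
    by (rule subgroup.subgroup_is_group[OF _ group_BijGroup])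
  moreover have "BijGroup T\<lparr>carrier := carrier SU\<rparr> = SU"
    by (simp add: SU_group_def)
  ultimately show ?thesis by simp
qed

section \<open>The action on special planes\<close>

lemma plane_image_oriented_span:
  assumes h: "h \<in> carrier SU" and w: "w \<in> {..<n} \<rightarrow> T"
  shows "plane_image n h (oriented_span n w) = oriented_span n (\<lambda>i\<in>{..<n}. h (w i))"
proof -
  have *: "(\<lambda>i\<in>{..<n}. h (frame_act n B w i)) = frame_act n B (\<lambda>i\<in>{..<n}. h (w i))" for B
  proof -
    have "h (\<Sum>j<n. (B $$ (i, j)) *\<^sub>R w j) = (\<Sum>j<n. (B $$ (i, j)) *\<^sub>R h (w j))" for i
      using SU_sum[OF h, of n w "\<lambda>j. of_real (B $$ (i, j))"] w by (auto simp: Pi_def)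
    then show ?thesis by (auto simp: frame_act_def fun_eq_iff)
  qed
  show ?thesis
    unfolding plane_image_def oriented_span_alt using * by (auto simp: image_iff) metis
qed

lemma special_frames_SU:
  assumes h: "h \<in> carrier SU" and e: "e \<in> special_frames"
  shows "(\<lambda>i\<in>{..<n}. h (e i)) \<in> special_frames"
proof -
  have eu: "unitary n e" and e1: "\<psi> e = 1" and eT: "e \<in> {..<n} \<rightarrow> T"
    using e by (auto simp: special_frames_def)
  have "unitary n (\<lambda>i\<in>{..<n}. h (e i))"
    using SU_unitary[OF h eu] by (auto simp: unitary_def)
  moreover have "\<psi> (\<lambda>i\<in>{..<n}. h (e i)) = \<psi> (\<lambda>i. h (e i))" by (intro psi_cong) simp
  ultimately show ?thesis
    using SU_psi[OF h eT] e1 eT SU_T[OF h] by (auto simp: special_frames_def)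
qed

text \<open>The action laws are checked on tuples: their entries lie in \<open>T\<close>, where
  products and the unit of the group are given by composition and identity, and extensionality
  absorbs the restriction in \<open>plane_image\<close>.\<close>

lemma special_planes_elem:
  assumes "\<xi> \<in> special_planes" "w \<in> \<xi>"
  shows "w \<in> {..<n} \<rightarrow>\<^sub>E T"
  using assms unfolding special_planes_eq
  by (force simp: special_frames_def oriented_span_def)

lemma group_action_special_planes:
  "group_action SU special_planes (\<lambda>h. restrict (plane_image n h) special_planes)"
proof (rule group_actionI[OF group_SU])
  fix h \<xi> assume h: "h \<in> carrier SU" and "\<xi> \<in> special_planes"
  then obtain e where e: "e \<in> special_frames" "\<xi> = oriented_span n e" by (auto simp: special_planes_eq)
  then have "e \<in> {..<n} \<rightarrow> T" by (auto simp: special_frames_def)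
  then show "plane_image n h \<xi> \<in> special_planes"
    using plane_image_oriented_span[OF h] special_frames_SU[OF h e(1)]
    by (auto simp: special_planes_eq e(2))
next
  fix \<xi> assume \<xi>: "\<xi> \<in> special_planes"
  have "(\<lambda>i\<in>{..<n}. \<one>\<^bsub>SU\<^esub> (w i)) = w" if "w \<in> \<xi>" for w
    using special_planes_elem[OF \<xi> that] by (auto simp: SU_one fun_eq_iff PiE_def extensional_def)
  then show "plane_image n \<one>\<^bsub>SU\<^esub> \<xi> = \<xi>" by (simp add: plane_image_def)
next
  fix g h \<xi> assume gh: "g \<in> carrier SU" "h \<in> carrier SU" and \<xi>: "\<xi> \<in> special_planes"
  have "(\<lambda>i\<in>{..<n}. compose T g h (w i)) = (\<lambda>i\<in>{..<n}. g ((\<lambda>i\<in>{..<n}. h (w i)) i))" if "w \<in> \<xi>" for w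
    using special_planes_elem[OF \<xi> that] by (auto simp: fun_eq_iff compose_def)
  then show "plane_image n (g \<otimes>\<^bsub>SU\<^esub> h) \<xi> = plane_image n g (plane_image n h \<xi>)"
    by (simp add: plane_image_def SU_mult[OF gh] image_image cong: image_cong)
qed

text \<open>Lift both planes to special frames; the common value \<open>1\<close> of
  \<open>\<psi>\<close> is what puts the connecting frame map into the group.\<close>

lemma special_planes_transitive:
  assumes e: "e \<in> special_frames" and \<xi>: "\<xi> \<in> special_planes"
  shows "\<exists>h\<in>carrier SU. plane_image n h (oriented_span n e) = \<xi>"
proof -
  obtain f where f: "f \<in> special_frames" "\<xi> = oriented_span n f" using \<xi> by (auto simp: special_planes_eq)
  have eu: "unitary n e" and eT: "e \<in> {..<n} \<rightarrow> T" and "\<psi> e = 1"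
    using e by (auto simp: special_frames_def)
  moreover have fu: "unitary n f" and fE: "f \<in> extensional {..<n}" and "\<psi> f = 1"
    using f(1) by (auto simp: special_frames_def PiE_def)
  ultimately have eq: "\<psi> e = \<psi> f" by simp
  let ?h = "frame_map e f"
  have h: "?h \<in> carrier SU" using frame_map_SU[OF eu fu eq] .
  have "(\<lambda>i\<in>{..<n}. ?h (e i)) = f"
    using fE frame_map_frame[OF eu fu] by (auto simp: fun_eq_iff extensional_def)
  then show ?thesis using plane_image_oriented_span[OF h eT] f(2) h by auto
qed

text \<open>A single orbit also requires that there is a plane at all, which is where the existence
  of a special frame enters.\<close>

lemma orbits_special_planes:
  "orbits SU special_planes (\<lambda>h. restrict (plane_image n h) special_planes) = {special_planes}"
proof -
  let ?act = "\<lambda>h. restrict (plane_image n h) special_planes"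
  interpret A: group_action SU special_planes ?act by (rule group_action_special_planes)
  have orb: "orbit SU ?act \<xi> = special_planes" if \<xi>: "\<xi> \<in> special_planes" for \<xi>
  proof
    show "orbit SU ?act \<xi> \<subseteq> special_planes"
    proof
      fix \<eta> assume "\<eta> \<in> orbit SU ?act \<xi>"
      then obtain g where "g \<in> carrier SU" "?act g \<xi> = \<eta>" unfolding orbit_def by blast
      then show "\<eta> \<in> special_planes" using A.element_image \<xi> by blast
    qed
    obtain e where e: "e \<in> special_frames" "\<xi> = oriented_span n e" using \<xi> by (auto simp: special_planes_eq)
    show "special_planes \<subseteq> orbit SU ?act \<xi>"
    proof
      fix \<eta> assume "\<eta> \<in> special_planes"
      then obtain h where h: "h \<in> carrier SU" "plane_image n h \<xi> = \<eta>"
        unfolding e(2) using special_planes_transitive[OF e(1)] by blast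
      then have "?act h \<xi> = \<eta>" using \<xi> by simp
      then show "\<eta> \<in> orbit SU ?act \<xi>" unfolding orbit_def using h(1) by blast
    qed
  qed
  have "special_planes \<noteq> {}" using exists_special_frame by (auto simp: special_planes_eq)
  then obtain \<xi> where \<xi>: "\<xi> \<in> special_planes" by blast
  show ?thesis
    unfolding orbits_def
  proof (intro equalityI subsetI)
    fix Q assume "Q \<in> {orbit SU ?act x |x. x \<in> special_planes}"
    then show "Q \<in> {special_planes}" using orb by blast
  next
    fix Q assume "Q \<in> {special_planes}"
    then show "Q \<in> {orbit SU ?act x |x. x \<in> special_planes}" using orb[OF \<xi>] \<xi> by blast
  qed
qed

text \<open>The columns of \<open>B\<close> hold the images of the frame vectors, as in
  \<open>has_matrix\<close>; this makes the map multiplicative rather than order reversing.\<close>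

definition matrix_map :: "(nat \<Rightarrow> 't) \<Rightarrow> complex mat \<Rightarrow> 't \<Rightarrow> 't" where
  "matrix_map e B = frame_map e (\<lambda>j. \<Sum>i<n. (B $$ (i, j)) \<star> e i)"

text \<open>Column orthonormality is the left inverse relation for \<open>mat_adjoint B\<close>,
  whereas the group is defined by the right one. The value of \<open>\<psi>\<close> goes through the
  transpose because \<open>psi_det\<close> combines vectors by rows.\<close>

lemma unitary_columns:
  assumes e: "unitary n e" and B: "B \<in> carrier (SU_mat n)"
  shows "unitary n (\<lambda>j. \<Sum>i<n. (B $$ (i, j)) \<star> e i)" "\<psi> (\<lambda>j. \<Sum>i<n. (B $$ (i, j)) \<star> e i) = \<psi> e"
proof -
  note eT = unitary_T[OF e]
  have c: "B \<in> carrier_mat n n" "Determinant.det B = 1" using B by (auto simp: SU_mat_carrier)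
  let ?f = "\<lambda>j. \<Sum>i<n. (B $$ (i, j)) \<star> e i"
  have fT: "?f j \<in> T" for j using eT by auto
  have "herm (?f j) (?f k) = (if j = k then 1 else 0)" if jk: "j < n" "k < n" for j k
  proof -
    have "herm (?f j) (?f k) = (\<Sum>i<n. herm (?f j) (e i) * cnj (herm (?f k) (e i)))"
      by (rule herm_parseval[OF e fT fT])
    also have "\<dots> = (\<Sum>i<n. cnj (B $$ (i, k)) * B $$ (i, j))"
      using herm_unitary_sum[OF e] by (intro sum.cong refl) (simp add: mult.commute)
    also have "\<dots> = (mat_adjoint B * B) $$ (k, j)"
      using c jk by (simp add: scalar_prod_def mat_adjoint_index[OF c(1)] atLeast0LessThan carrier_matD[OF mat_adjoint_carrier[OF c(1)]])
    also have "\<dots> = (if j = k then 1 else 0)" using jk by (simp add: SU_mat_adjoint_left[OF B])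
    finally show ?thesis .
  qed
  then show "unitary n ?f" using fT by (auto simp: unitary_def)
  have "\<psi> ?f = \<psi> (\<lambda>j. \<Sum>i<n. (transpose_mat B $$ (j, i)) \<star> e i)"
    using c by (intro psi_cong) simp
  also have "\<dots> = \<psi> e"
    using psi_det[of e "transpose_mat B"] eT c det_transpose[OF c(1)] by simp
  finally show "\<psi> ?f = \<psi> e" .
qed

lemma matrix_map_SU: "unitary n e \<Longrightarrow> B \<in> carrier (SU_mat n) \<Longrightarrow> matrix_map e B \<in> carrier SU"
  unfolding matrix_map_def using unitary_columns by (intro frame_map_SU) auto

lemma matrix_map_frame:
  "\<lbrakk>unitary n e; B \<in> carrier (SU_mat n); j < n\<rbrakk> \<Longrightarrow> matrix_map e B (e j) = (\<Sum>i<n. (B $$ (i, j)) \<star> e i)"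
  unfolding matrix_map_def by (intro frame_map_frame unitary_columns)

lemma herm_matrix_map:
  "\<lbrakk>unitary n e; B \<in> carrier (SU_mat n); i < n; j < n\<rbrakk> \<Longrightarrow> herm (matrix_map e B (e j)) (e i) = B $$ (i, j)"
  using herm_unitary_sum[of n e i "\<lambda>i. B $$ (i, j)"] by (simp add: matrix_map_frame)

lemma matrix_map_iso:
  assumes e: "unitary n e"
  shows "matrix_map e \<in> iso (SU_mat n) SU"
proof (rule isoI)
  note eT = unitary_T[OF e]
  show "matrix_map e \<in> hom (SU_mat n) SU"
  proof (rule homI)
    fix A B assume AB: "A \<in> carrier (SU_mat n)" "B \<in> carrier (SU_mat n)"
    note mA = matrix_map_SU[OF e AB(1)] and mB = matrix_map_SU[OF e AB(2)]
    have c: "A \<in> carrier_mat n n" "B \<in> carrier_mat n n" using AB by (auto simp: SU_mat_carrier)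
    have AB': "A * B \<in> carrier (SU_mat n)"
      using monoid.m_closed[OF group.is_monoid[OF group_SU_mat] AB] by (simp add: SU_mat_def)
    have "matrix_map e (A * B) (e j) = compose T (matrix_map e A) (matrix_map e B) (e j)" if j: "j < n" for j
    proof -
      have "compose T (matrix_map e A) (matrix_map e B) (e j)
          = matrix_map e A (\<Sum>k<n. (B $$ (k, j)) \<star> e k)"
        using eT[OF j] by (simp add: compose_def matrix_map_frame[OF e AB(2) j])
      also have "\<dots> = (\<Sum>k<n. (B $$ (k, j)) \<star> (\<Sum>i<n. (A $$ (i, k)) \<star> e i))"
        using SU_sum[OF mA, of n e "\<lambda>k. B $$ (k, j)"] eT by (simp add: matrix_map_frame[OF e AB(1)])
      also have "\<dots> = (\<Sum>k<n. \<Sum>i<n. (A $$ (i, k) * B $$ (k, j)) \<star> e i)"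
        using eT by (intro sum.cong refl) (simp add: cscale_sum_right cscale_cscale mult.commute)
      also have "\<dots> = (\<Sum>i<n. \<Sum>k<n. (A $$ (i, k) * B $$ (k, j)) \<star> e i)" by (rule sum.swap)
      also have "\<dots> = (\<Sum>i<n. ((A * B) $$ (i, j)) \<star> e i)"
        using c j by (intro sum.cong refl) (simp add: scalar_prod_def atLeast0LessThan cscale_sum_left)
      finally show ?thesis using matrix_map_frame[OF e AB' j] by simp
    qed
    then have "matrix_map e (A * B) = compose T (matrix_map e A) (matrix_map e B)"
      by (intro SU_ext[OF matrix_map_SU[OF e AB'] SU_compose[OF mA mB] e])
    then show "matrix_map e (A \<otimes>\<^bsub>SU_mat n\<^esub> B) = matrix_map e A \<otimes>\<^bsub>SU\<^esub> matrix_map e B"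
      unfolding SU_mult[OF mA mB] by (simp add: SU_mat_def)
  qed (rule matrix_map_SU[OF e])
  show "bij_betw (matrix_map e) (carrier (SU_mat n)) (carrier SU)"
  proof (rule bij_betw_imageI)
    show "inj_on (matrix_map e) (carrier (SU_mat n))"
    proof (rule inj_onI)
      fix A B assume AB: "A \<in> carrier (SU_mat n)" "B \<in> carrier (SU_mat n)" "matrix_map e A = matrix_map e B"
      then show "A = B"
        using herm_matrix_map[OF e AB(1)] herm_matrix_map[OF e AB(2)]
        by (intro eq_matI) (auto simp: SU_mat_carrier)
    qed
    show "matrix_map e ` carrier (SU_mat n) = carrier SU"
    proof
      show "matrix_map e ` carrier (SU_mat n) \<subseteq> carrier SU" using matrix_map_SU[OF e] by auto
      show "carrier SU \<subseteq> matrix_map e ` carrier (SU_mat n)"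
      proof
        fix h assume h: "h \<in> carrier SU"
        note hT = SU_T[OF h eT]
        \<comment> \<open>The coordinates of the images of the frame. Parseval turns preservation of
          \<open>herm\<close> into unitarity of \<open>B\<close>.\<close>
        define B where "B = mat n n (\<lambda>(i,j). herm (h (e j)) (e i))"
        have Bc: "B \<in> carrier_mat n n" by (simp add: B_def)
        have "mat_adjoint B * B = 1\<^sub>m n"
        proof (rule eq_matI)
          fix k j assume "k < dim_row (1\<^sub>m n :: complex mat)" "j < dim_col (1\<^sub>m n :: complex mat)"
          then have kj: "k < n" "j < n" by auto
          have "(mat_adjoint B * B) $$ (k, j) = (\<Sum>i<n. cnj (B $$ (i, k)) * B $$ (i, j))"
            using Bc kj by (simp add: scalar_prod_def mat_adjoint_index[OF Bc] atLeast0LessThan carrier_matD[OF mat_adjoint_carrier[OF Bc]])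
          also have "\<dots> = herm (h (e j)) (h (e k))"
            unfolding herm_parseval[OF e hT[OF kj(2)] hT[OF kj(1)]]
            using kj by (intro sum.cong refl) (simp add: B_def mult.commute)
          also have "\<dots> = (1\<^sub>m n) $$ (k, j)"
            using kj eT by (simp add: SU_herm[OF h] unitary_herm[OF e])
          finally show "(mat_adjoint B * B) $$ (k, j) = (1\<^sub>m n) $$ (k, j)" .
        qed (use Bc carrier_matD[OF mat_adjoint_carrier[OF Bc]] in simp_all)
        then have "B * mat_adjoint B = 1\<^sub>m n"
          by (rule mat_mult_left_right_inverse[OF mat_adjoint_carrier[OF Bc] Bc])
        moreover have "Determinant.det B = 1"
        proof -
          \<comment> \<open>Preservation of \<open>\<psi>\<close> makes \<open>\<psi> e\<close>
            equal to itself times the determinant of \<open>B\<close>; its modulus is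
            \<open>1\<close>, so it cancels.\<close>
          have "\<psi> e = \<psi> (\<lambda>i. h (e i))" using eT by (intro SU_psi[OF h, symmetric]) auto
          also have "\<dots> = Determinant.det (mat n n (\<lambda>(i,j). herm (h (e i)) (e j))) * \<psi> e"
            using hT by (intro psi_coords[OF e]) auto
          also have "mat n n (\<lambda>(i,j). herm (h (e i)) (e j)) = transpose_mat B"
            by (intro eq_matI) (auto simp: B_def)
          also have "Determinant.det \<dots> = Determinant.det B" by (rule det_transpose[OF Bc])
          finally show ?thesis using norm_psi_unitary[OF e] by auto
        qed
        ultimately have B: "B \<in> carrier (SU_mat n)" using Bc by (simp add: SU_mat_carrier)
        have "matrix_map e B (e j) = h (e j)" if j: "j < n" for j
          unfolding matrix_map_frame[OF e B j]
          using unitary_expand[OF e hT[OF j]] j by (simp add: B_def)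
        then have "matrix_map e B = h" by (intro SU_ext[OF matrix_map_SU[OF e B] h e])
        then show "h \<in> matrix_map e ` carrier (SU_mat n)" using B by auto
      qed
    qed
  qed
qed

text \<open>If the plane of \<open>e\<close> is fixed, the columns of \<open>B\<close> express real
  combinations of \<open>e\<close>, and uniqueness of complex coordinates makes \<open>B\<close>
  real. Conversely, a real special orthogonal matrix is a base change of positive
  determinant.\<close>

lemma stabilizer_SO:
  assumes e: "e \<in> special_frames"
  shows "SO_mat n = {B \<in> carrier (SU_mat n). plane_image n (matrix_map e B) (oriented_span n e) = oriented_span n e}"
proof -
  have eu: "unitary n e" and eT': "e \<in> {..<n} \<rightarrow> T"
    using e by (auto simp: special_frames_def)
  note eT = unitary_T[OF eu]
  have im: "plane_image n (matrix_map e B) (oriented_span n e)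
      = oriented_span n (\<lambda>j\<in>{..<n}. \<Sum>i<n. (B $$ (i, j)) \<star> e i)" if "B \<in> carrier (SU_mat n)" for B
    unfolding plane_image_oriented_span[OF matrix_map_SU[OF eu that] eT']
    by (intro arg_cong[of _ _ "oriented_span n"] restrict_ext) (simp add: matrix_map_frame[OF eu that])
  show ?thesis
  proof (intro equalityI subsetI)
    fix B assume "B \<in> SO_mat n"
    then obtain R :: "real mat" where R: "R \<in> carrier_mat n n" "R * transpose_mat R = 1\<^sub>m n"
      "Determinant.det R = 1" "B = map_mat complex_of_real R"
      by (auto simp: SO_mat_def)
    have "mat_adjoint B = map_mat complex_of_real (transpose_mat R)"
      using R by (intro eq_matI) (auto simp: mat_adjoint_alt[of _ n])
    then have "B * mat_adjoint B = map_mat complex_of_real (R * transpose_mat R)"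
      using map_mat_of_real_mult[OF R(1), of "transpose_mat R"] R(1,4) by simp
    then have B: "B \<in> carrier (SU_mat n)"
      using R by (simp add: SU_mat_carrier of_real_hom.mat_hom_one)
    \<comment> \<open>\<open>frame_act\<close> combines vectors by rows while \<open>B\<close>
      stores images in columns, hence the transpose.\<close>
    have "(\<lambda>j\<in>{..<n}. \<Sum>i<n. (B $$ (i, j)) \<star> e i) = frame_act n (transpose_mat R) e"
      using R by (auto simp: frame_act_def fun_eq_iff intro!: sum.cong)
    then show "B \<in> {B \<in> carrier (SU_mat n). plane_image n (matrix_map e B) (oriented_span n e) = oriented_span n e}"
      using B im[OF B] R det_transpose[OF R(1)] oriented_span_frame_act[of "transpose_mat R" n e] by simp
  next
    fix B assume "B \<in> {B \<in> carrier (SU_mat n). plane_image n (matrix_map e B) (oriented_span n e) = oriented_span n e}"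
    then have B: "B \<in> carrier (SU_mat n)"
      and eq: "oriented_span n (\<lambda>j\<in>{..<n}. \<Sum>i<n. (B $$ (i, j)) \<star> e i) = oriented_span n e"
      using im by auto
    have "(\<lambda>j\<in>{..<n}. \<Sum>i<n. (B $$ (i, j)) \<star> e i) \<in> oriented_span n e"
      unfolding eq[symmetric] by (intro oriented_span_self) simp
    then obtain A where A: "A \<in> carrier_mat n n"
      "(\<lambda>j\<in>{..<n}. \<Sum>i<n. (B $$ (i, j)) \<star> e i) = frame_act n A e"
      by (auto simp: oriented_span_alt)
    have Bc: "B \<in> carrier_mat n n" using B by (simp add: SU_mat_carrier)
    have BA: "B $$ (i, j) = complex_of_real (A $$ (j, i))" if ij: "i < n" "j < n" for i j
    proof -
      have "(\<Sum>i<n. (B $$ (i, j)) \<star> e i) = (\<Sum>i<n. complex_of_real (A $$ (j, i)) \<star> e i)"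
        using fun_cong[OF A(2), of j] ij by (simp add: frame_act_def)
      then show ?thesis
        using herm_unitary_sum[OF eu ij(1), of "\<lambda>i. B $$ (i, j)"]
          herm_unitary_sum[OF eu ij(1), of "\<lambda>i. complex_of_real (A $$ (j, i))"] by simp
    qed
    let ?R = "transpose_mat A"
    have Rc: "?R \<in> carrier_mat n n" using A by simp
    have BR: "B = map_mat complex_of_real ?R" using BA A(1) Bc by (intro eq_matI) auto
    have "Determinant.det B = complex_of_real (Determinant.det ?R)" unfolding BR by simp
    then have "Determinant.det ?R = 1" using B by (simp add: SU_mat_carrier)
    moreover have "mat_adjoint B = map_mat complex_of_real (transpose_mat ?R)"
      using Rc by (intro eq_matI) (auto simp: BR mat_adjoint_alt[of _ n])
    then have "map_mat complex_of_real (?R * transpose_mat ?R) = 1\<^sub>m n"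
      using B Rc map_mat_of_real_mult[OF Rc, of "transpose_mat ?R"]
      by (simp add: SU_mat_carrier BR)
    then have "map_mat complex_of_real (?R * transpose_mat ?R) = map_mat complex_of_real (1\<^sub>m n)"
      by (simp add: of_real_hom.mat_hom_one)
    then have "?R * transpose_mat ?R = 1\<^sub>m n" by (rule of_real_hom.mat_hom_inj)
    ultimately show "B \<in> SO_mat n" using Rc BR by (auto simp: SO_mat_def)
  qed
qed

text \<open>The base point is the plane of a special frame, and the same frame supplies the
  matrices; a merely unitary frame could span a plane outside the contact set.\<close>

lemma special_planes_homogeneous:
  "\<exists>e \<Phi> F. unitary_frame T G J n e \<and>
     (\<forall>B\<in>carrier (SU_mat n). has_matrix J n e (\<Phi> B) B) \<and>
     homogeneous_space_iso (SU_mat n) (SO_mat n) SU special_planes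
       (\<lambda>h. restrict (plane_image n h) special_planes) \<Phi> F"
proof -
  obtain e where e: "e \<in> special_frames" using exists_special_frame by auto
  then have eu: "unitary n e" by (simp add: special_frames_def)
  let ?act = "\<lambda>h. restrict (plane_image n h) special_planes"
  have x: "oriented_span n e \<in> special_planes" using e by (auto simp: special_planes_eq)
  have "\<exists>F. homogeneous_space_iso (SU_mat n) (SO_mat n) SU special_planes ?act (matrix_map e) F"
  proof (rule homogeneous_space_isoI[OF group_SU_mat matrix_map_iso[OF eu] group_action_special_planes x])
    show "\<exists>h\<in>carrier SU. ?act h (oriented_span n e) = \<xi>" if "\<xi> \<in> special_planes" for \<xi>
      using special_planes_transitive[OF e that] x by simp
    show "SO_mat n = {B \<in> carrier (SU_mat n). ?act (matrix_map e B) (oriented_span n e) = oriented_span n e}"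
      using stabilizer_SO[OF e] x by simp
  qed
  moreover have "has_matrix J n e (matrix_map e B) B" if "B \<in> carrier (SU_mat n)" for B
    using matrix_map_frame[OF eu that] by (simp add: has_matrix_def cscale_def)
  ultimately show ?thesis using eu unitary_frame_iff by blast
qed

end


section \<open>Tangent spaces\<close>

text \<open>Stated for a function \<open>f'\<close> that equals \<open>h \<circ> f\<close> only on
  \<open>S\<close>, because the induction compares Frechet derivatives and these are known to agree
  only on \<open>S\<close>; openness of \<open>S\<close> makes agreement there enough for the
  derivatives.\<close>

lemma Ck_on_bounded_linear:
  assumes h: "bounded_linear h" and S: "open S"
  shows "Ck_on k f S \<Longrightarrow> (\<And>x. x \<in> S \<Longrightarrow> f' x = h (f x)) \<Longrightarrow> Ck_on k f' S"
proof (induction k arbitrary: f f')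
  case 0
  then show ?case
    using bounded_linear.continuous_on[OF h, of S f] by (simp cong: continuous_on_cong)
next
  case (Suc k)
  have der: "(f' has_derivative (\<lambda>v. h (frechet_derivative f (at x) v))) (at x)" if x: "x \<in> S" for x
  proof -
    have "(f has_derivative frechet_derivative f (at x)) (at x)"
      using Suc.prems(1) x by (simp add: frechet_derivative_works)
    then have "((\<lambda>x. h (f x)) has_derivative (\<lambda>v. h (frechet_derivative f (at x) v))) (at x)"
      by (rule bounded_linear.has_derivative[OF h])
    then show ?thesis
      by (rule has_derivative_transform_within_open[OF _ S x]) (simp add: Suc.prems(2))
  qed
  have "Ck_on k (\<lambda>x. frechet_derivative f' (at x) v) S" for v
  proof (rule Suc.IH)
    show "Ck_on k (\<lambda>x. frechet_derivative f (at x) v) S" using Suc.prems(1) by simp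
    show "frechet_derivative f' (at x) v = h (frechet_derivative f (at x) v)" if "x \<in> S" for x
      using frechet_derivative_at[OF der[OF that]] by metis
  qed
  then show ?case using der by (auto simp: differentiable_def)
qed

lemma smooth_on_bounded_linear:
  "\<lbrakk>bounded_linear h; open S; smooth_on f S\<rbrakk> \<Longrightarrow> smooth_on (\<lambda>x. h (f x)) S"
  unfolding smooth_on_def by (blast intro: Ck_on_bounded_linear)

lemma smooth_on_has_derivative:
  assumes "smooth_on f S" "x \<in> S"
  shows "(f has_derivative frechet_derivative f (at x)) (at x)"
proof -
  have "Ck_on 1 f S" using assms(1) by (simp only: smooth_on_def)
  then show ?thesis using assms(2) by (simp add: frechet_derivative_works)
qed

section \<open>Charts, transition differentials and the dimension of the tangent space\<close>

context
  fixes X :: "'a topology" and A :: "('a, 'e::euclidean_space) chart set"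
  assumes M: "smooth_manifold X A"
begin

lemma chart_openin: "c \<in> A \<Longrightarrow> openin X (fst c)"
  and chart_image_open: "c \<in> A \<Longrightarrow> open (snd c ` fst c)"
  and chart_homeomorphic: "c \<in> A \<Longrightarrow>
    homeomorphic_map (subtopology X (fst c)) (top_of_set (snd c ` fst c)) (snd c)"
  and chart_cover: "(\<Union>c\<in>A. fst c) = topspace X"
  and transition_smooth: "c \<in> A \<Longrightarrow> d \<in> A \<Longrightarrow> smooth_on (transition c d) (snd c ` (fst c \<inter> fst d))"
  using M by (auto simp: smooth_manifold_def)

lemma chart_inj:
  assumes "c \<in> A"
  shows "inj_on (snd c) (fst c)"
proof -
  have "topspace (subtopology X (fst c)) = fst c"
    using openin_subset[OF chart_openin[OF assms]] by auto
  then show ?thesis using chart_homeomorphic[OF assms] by (simp add: homeomorphic_map_def)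
qed

lemma chart_inv_chart: "c \<in> A \<Longrightarrow> p \<in> fst c \<Longrightarrow> chart_inv c (snd c p) = p"
  by (simp add: chart_inv_def chart_inj)

lemma transition_chart: "c \<in> A \<Longrightarrow> p \<in> fst c \<Longrightarrow> transition c d (snd c p) = snd d p"
  by (simp add: transition_def chart_inv_chart)

lemma open_chart_overlap:
  assumes c: "c \<in> A" and d: "d \<in> A"
  shows "open (snd c ` (fst c \<inter> fst d))"
proof -
  have "openin (subtopology X (fst c)) (fst c \<inter> fst d)"
    using chart_openin[OF d] by (simp add: openin_subtopology_Int2)
  then have "openin (top_of_set (snd c ` fst c)) (snd c ` (fst c \<inter> fst d))"
    using homeomorphic_imp_open_map[OF chart_homeomorphic[OF c]] by (simp add: open_map_def)
  then show ?thesis using chart_image_open[OF c] by (rule openin_open_trans)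
qed

lemma transition_has_derivative:
  assumes "c \<in> A" "d \<in> A" "p \<in> fst c" "p \<in> fst d"
  shows "(transition c d has_derivative frechet_derivative (transition c d) (at (snd c p))) (at (snd c p))"
  using assms by (intro smooth_on_has_derivative[OF transition_smooth]) auto

lemma linear_transition_derivative:
  assumes "c \<in> A" "d \<in> A" "p \<in> fst c" "p \<in> fst d"
  shows "linear (frechet_derivative (transition c d) (at (snd c p)))"
  using transition_has_derivative[OF assms] by (rule has_derivative_linear)

text \<open>Chain rule. The composite agrees with the direct transition only near the point, so the
  comparison is made on an open set of common coordinates.\<close>

lemma transition_derivative_cocycle:
  assumes c: "c \<in> A" "p \<in> fst c" and d: "d \<in> A" "p \<in> fst d" and d': "d' \<in> A" "p \<in> fst d'"
  shows "frechet_derivative (transition c d') (at (snd c p)) a =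
    frechet_derivative (transition d d') (at (snd d p)) (frechet_derivative (transition c d) (at (snd c p)) a)"
proof -
  let ?U = "snd c ` (fst c \<inter> fst d) \<inter> snd c ` (fst c \<inter> fst d')"
  have "(transition d d' has_derivative frechet_derivative (transition d d') (at (snd d p)))
      (at (transition c d (snd c p)))"
    using transition_has_derivative[OF d(1) d'(1) d(2) d'(2)] by (simp add: transition_chart c)
  then have "(transition d d' \<circ> transition c d has_derivative
      frechet_derivative (transition d d') (at (snd d p)) \<circ> frechet_derivative (transition c d) (at (snd c p)))
      (at (snd c p))"
    by (rule diff_chain_at[OF transition_has_derivative[OF c(1) d(1) c(2) d(2)]])
  moreover have "open ?U" using open_chart_overlap c d d' by blast
  moreover have "snd c p \<in> ?U" using c d d' by auto
  moreover have "(transition d d' \<circ> transition c d) x = transition c d' x" if x: "x \<in> ?U" for x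
  proof -
    obtain q where q: "q \<in> fst c" "q \<in> fst d" "x = snd c q" using x by blast
    then show ?thesis using c d by (simp add: transition_chart)
  qed
  ultimately have "(transition c d' has_derivative
      frechet_derivative (transition d d') (at (snd d p)) \<circ> frechet_derivative (transition c d) (at (snd c p)))
      (at (snd c p))"
    by (rule has_derivative_transform_within_open)
  from frechet_derivative_at[OF this] show ?thesis by (metis comp_apply)
qed

lemma transition_derivative_self:
  assumes c: "c \<in> A" "p \<in> fst c"
  shows "frechet_derivative (transition c c) (at (snd c p)) a = a"
proof -
  have "(transition c c has_derivative (\<lambda>x. x)) (at (snd c p))"
    using has_derivative_ident chart_image_open[OF c(1)]
    by (rule has_derivative_transform_within_open) (use c in \<open>auto simp: transition_chart\<close>)
  from frechet_derivative_at[OF this] show ?thesis by metis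
qed

lemma subspace_tangent_space: "real_vector.subspace (tangent_space A p)"
proof (rule real_vector.subspaceI)
  let ?D = "\<lambda>c d. frechet_derivative (transition c d) (at (snd c p))"
  have l: "linear (?D c d)" if "c \<in> A" "d \<in> A" "p \<in> fst c \<and> p \<in> fst d" for c d
    using linear_transition_derivative that by blast
  have out: "v c = 0" if "v \<in> tangent_space A p" "\<not> (c \<in> A \<and> p \<in> fst c)" for v c
    using that unfolding tangent_space_def by blast
  have tr: "v d = ?D c d (v c)"
    if "v \<in> tangent_space A p" "c \<in> A" "d \<in> A" "p \<in> fst c \<and> p \<in> fst d" for v c d
    using that unfolding tangent_space_def by blast
  show "0 \<in> tangent_space A p"
    using linear_0[OF l] by (auto simp: tangent_space_def)
  show "u + v \<in> tangent_space A p" if uv: "u \<in> tangent_space A p" "v \<in> tangent_space A p" for u v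
    unfolding tangent_space_def
  proof (intro CollectI conjI allI ballI impI)
    show "(u + v) c = 0" if "\<not> (c \<in> A \<and> p \<in> fst c)" for c
      using out[OF uv(1) that] out[OF uv(2) that] by simp
    show "(u + v) d = ?D c d ((u + v) c)" if cd: "c \<in> A" "d \<in> A" "p \<in> fst c \<and> p \<in> fst d" for c d
      unfolding plus_fun_apply tr[OF uv(1) cd] tr[OF uv(2) cd] by (rule linear_add[OF l[OF cd], symmetric])
  qed
  show "r *\<^sub>R u \<in> tangent_space A p" if u: "u \<in> tangent_space A p" for r u
    unfolding tangent_space_def
  proof (intro CollectI conjI allI ballI impI)
    show "(r *\<^sub>R u) c = 0" if "\<not> (c \<in> A \<and> p \<in> fst c)" for c
      using out[OF u that] by simp
    show "(r *\<^sub>R u) d = ?D c d ((r *\<^sub>R u) c)" if cd: "c \<in> A" "d \<in> A" "p \<in> fst c \<and> p \<in> fst d" for c d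
      unfolding scaleR_fun_apply tr[OF u cd] by (rule linear_scale[OF l[OF cd], symmetric])
  qed
qed

text \<open>In a chart \<open>c\<close> at \<open>p\<close>, the map
  \<open>coord_vector A c p\<close> is a linear isomorphism from the model space, inverted by
  evaluation at \<open>c\<close>; the cocycle rule puts its values into the tangent space. The image
  of the standard basis is the required basis.\<close>

lemma tangent_space_basis:
  assumes p: "p \<in> topspace X"
  shows "\<exists>S. finite S \<and> independent S \<and> span S = tangent_space A p \<and> card S = DIM('e)"
proof -
  have "p \<in> (\<Union>c\<in>A. fst c)" using p chart_cover by simp
  then obtain c where c: "c \<in> A" "p \<in> fst c" by (rule UN_E)
  let ?L = "coord_vector A c p"
  have lin: "linear ?L"
  proof (rule linearI)
    note l = linear_transition_derivative[OF c(1) _ c(2)]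
    show "?L (a + b) = ?L a + ?L b" for a b
      using linear_add[OF l] by (auto simp: coord_vector_def fun_eq_iff)
    show "?L (r *\<^sub>R a) = r *\<^sub>R ?L a" for r a
      using linear_scale[OF l] by (auto simp: coord_vector_def fun_eq_iff)
  qed
  have Lc: "?L a c = a" for a
    using c by (simp add: coord_vector_def transition_derivative_self)
  then have inj: "inj ?L" by (metis injI)
  have "range ?L = tangent_space A p"
  proof
    show "range ?L \<subseteq> tangent_space A p"
    proof (rule image_subsetI)
      fix a
      show "?L a \<in> tangent_space A p"
        unfolding tangent_space_def
      proof (intro CollectI conjI allI ballI impI)
        show "?L a d = 0" if "\<not> (d \<in> A \<and> p \<in> fst d)" for d
          using that by (simp only: coord_vector_def if_False)
        show "?L a d' = frechet_derivative (transition d d') (at (snd d p)) (?L a d)"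
          if d: "d \<in> A" "d' \<in> A" "p \<in> fst d \<and> p \<in> fst d'" for d d'
          unfolding coord_vector_def using d transition_derivative_cocycle[OF c, of d d' a]
          by (simp only: if_True simp_thms)
      qed
    qed
    show "tangent_space A p \<subseteq> range ?L"
    proof
      fix v assume v: "v \<in> tangent_space A p"
      have "?L (v c) = v"
      proof
        fix d
        show "?L (v c) d = v d"
        proof (cases "d \<in> A \<and> p \<in> fst d")
          case True
          have "\<forall>c\<in>A. \<forall>d\<in>A. p \<in> fst c \<and> p \<in> fst d \<longrightarrow>
              v d = frechet_derivative (transition c d) (at (snd c p)) (v c)"
            using v unfolding tangent_space_def by blast
          then have "v d = frechet_derivative (transition c d) (at (snd c p)) (v c)"
            using c True by blast
          then show ?thesis using True by (simp only: coord_vector_def if_True simp_thms)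
        next
          case False
          then have "v d = 0" using v unfolding tangent_space_def by blast
          then show ?thesis using False by (simp only: coord_vector_def if_False)
        qed
      qed
      then show "v \<in> range ?L" by (metis rangeI)
    qed
  qed
  then have "span (?L ` Basis) = tangent_space A p"
    using linear_span_image[OF lin, of Basis] by simp
  moreover have "independent (?L ` Basis)"
    using inj by (intro linear_independent_injective_image[OF lin independent_Basis]) (auto intro: inj_on_subset)
  moreover have "card (?L ` Basis) = DIM('e)"
    using inj by (intro card_image) (auto intro: inj_on_subset)
  ultimately show ?thesis by (intro exI[of _ "?L ` Basis"]) auto
qed

lemma differential_form_Re:
  assumes "differential_form X A m \<omega>"
  shows "differential_form X A m (\<lambda>p w. Re (\<omega> p w))"
  unfolding differential_form_def
proof (intro conjI ballI allI)
  fix p assume "p \<in> topspace X"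
  then have alt: "alternating_on (tangent_space A p) m (\<omega> p)"
    using assms by (simp add: differential_form_def)
  show "alternating_on (tangent_space A p) m (\<lambda>w. Re (\<omega> p w))"
    unfolding alternating_on_def
  proof (intro conjI allI ballI impI)
    show "Re (\<omega> p w) = Re (\<omega> p w')" if "\<forall>i<m. w i = w' i" for w w'
      using alternating_on_cong[OF alt, of w w'] that by simp
    show "Re (\<omega> p (w(k := a *\<^sub>R u + b *\<^sub>R v))) = a *\<^sub>R Re (\<omega> p (w(k := u))) + b *\<^sub>R Re (\<omega> p (w(k := v)))"
      if "w \<in> {..<m} \<rightarrow> tangent_space A p" "k < m" "u \<in> tangent_space A p" "v \<in> tangent_space A p" for w k u v a b
      unfolding alternating_on_lincomb[OF alt that] by simp
    show "Re (\<omega> p w) = 0"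
      if "w \<in> {..<m} \<rightarrow> tangent_space A p" "i < m" "j < m" "i \<noteq> j \<and> w i = w j" for w i j
      using alternating_on_eq_0[OF alt that(1,2,3)] that(4) by simp
  qed
next
  fix c a assume c: "c \<in> A"
  show "smooth_on (\<lambda>x. Re (\<omega> (chart_inv c x) (\<lambda>i. coord_vector A c (chart_inv c x) (a i)))) (snd c ` fst c)"
    by (rule smooth_on_bounded_linear[OF bounded_linear_Re chart_image_open[OF c]])
      (use assms c in \<open>simp add: differential_form_def\<close>)
qed

end

section \<open>From the manifold to one tangent space\<close>

lemma complex_volume_tangent_space:
  fixes A :: "('a, 'e::euclidean_space) chart set"
  assumes M: "almost_hermitian_manifold X A n g J" and form: "n0_form X A J n \<psi>"
    and vol: "volume_normalized X A n g J \<psi>" and p: "p \<in> topspace X"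
  shows "complex_volume (tangent_space A p) (g p) (J p) n (\<psi> p)"
proof
  have sm: "smooth_manifold X A" and dim: "DIM('e) = 2 * n"
    using M by (auto simp: almost_hermitian_manifold_def)
  show "real_vector.subspace (tangent_space A p)" by (rule subspace_tangent_space[OF sm])
  show "\<exists>S. finite S \<and> independent S \<and> span S = tangent_space A p \<and> card S = 2 * n"
    using tangent_space_basis[OF sm p] dim by simp
  \<comment> \<open>Euclidean spaces have positive dimension, which excludes
    \<open>n = 0\<close>.\<close>
  show "n > 0" using dim DIM_positive[where 'a='e] by linarith
qed (use assms in \<open>auto simp: almost_hermitian_manifold_def riemannian_metric_def
    almost_complex_structure_def n0_form_def differential_form_def volume_normalized_def\<close>)

theorem proposition2:
  fixes X :: "'a topology"
    and A :: "('a, 'e::euclidean_space) chart set"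
    and n :: nat
    and g :: "'a \<Rightarrow> ('a, 'e) tvec \<Rightarrow> ('a, 'e) tvec \<Rightarrow> real"
    and J :: "'a \<Rightarrow> ('a, 'e) tvec \<Rightarrow> ('a, 'e) tvec"
    and D :: "('a \<Rightarrow> ('a, 'e) tvec) \<Rightarrow> ('a \<Rightarrow> ('a, 'e) tvec) \<Rightarrow> ('a \<Rightarrow> ('a, 'e) tvec)"
    and \<psi> :: "'a \<Rightarrow> (nat \<Rightarrow> ('a, 'e) tvec) \<Rightarrow> complex"
  assumes "almost_hermitian_manifold X A n g J"
    and "n0_form X A J n \<psi>"
    and "nowhere_vanishing X A n \<psi>"
    and "affine_connection X A D"
    and "parallel_metric X A D g"
    and "parallel_endo X A D J"
    and "parallel_form X A D n \<psi>"
    and "volume_normalized X A n g J \<psi>"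
  shows "let \<phi> = (\<lambda>p w. Re (\<psi> p w)) in
    generalized_calibration X A g n \<phi> \<and>
    (\<forall>p\<in>topspace X.
       let SU = SU_group (tangent_space A p) (g p) (J p) n (\<psi> p);
           C = contact_set A g n \<phi> p;
           act = (\<lambda>h. restrict (plane_image n h) C)
       in group_action SU C act \<and> orbits SU C act = {C} \<and>
          (\<exists>e \<Phi> F. unitary_frame (tangent_space A p) (g p) (J p) n e \<and>
             (\<forall>B\<in>carrier (SU_mat n). has_matrix (J p) n e (\<Phi> B) B) \<and>
             homogeneous_space_iso (SU_mat n) (SO_mat n) SU C act \<Phi> F))"
proof -
  define \<phi> where "\<phi> = (\<lambda>p w. Re (\<psi> p w))"
  have sm: "smooth_manifold X A" using assms(1) by (simp add: almost_hermitian_manifold_def)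
  note vol = complex_volume_tangent_space[OF assms(1,2,8)]
  \<comment> \<open>By definition the contact set at \<open>p\<close> is the set of special planes
    of the tangent space, so the pointwise results apply as they stand.\<close>
  have contact: "contact_set A g n \<phi> p = complex_volume.special_planes (tangent_space A p) (g p) n (\<psi> p)"
    if "p \<in> topspace X" for p
    using complex_volume.special_planes_def[OF vol[OF that]] by (simp add: contact_set_def \<phi>_def)
  have "differential_form X A n \<phi>"
    using assms(2) differential_form_Re[OF sm] by (simp add: n0_form_def \<phi>_def)
  moreover have "eval_plane (g p) n (\<phi> p) \<xi> \<le> 1"
    if "p \<in> topspace X" "\<xi> \<in> oriented_planes (tangent_space A p) n" for p \<xi>
    using complex_volume.eval_plane_Re_psi_le[OF vol[OF that(1)] that(2)] by (simp add: \<phi>_def)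
  ultimately have "generalized_calibration X A g n \<phi>" by (simp add: generalized_calibration_def)
  then show ?thesis
    unfolding Let_def \<phi>_def[symmetric]
    using complex_volume.group_action_special_planes[OF vol]
      complex_volume.orbits_special_planes[OF vol]
      complex_volume.special_planes_homogeneous[OF vol]
    by (simp add: contact)
qed

end
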